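(* Let $\mathcal{V}$ be a measurable space, $\nu$ a non-atomic probability distribution on $\mathcal{V}$ and $\theta>0$. Let $P\sim\mathrm{DP}(\theta,\nu)$ and, conditionally on $P$, let $X_1,\ldots,X_m,X_{m+1},X_{m+2}$ ($m\geq1$) be i.i.d. from $P$. Let $J\geq2$ be an integer and $h:\mathcal{V}\to[J]$ a random hash function drawn from a pairwise independent perfectly random hash family, independent of $(P,X_1,\ldots,X_{m+2})$. For $r=1,2$ let $f_{X_{m+r}}=\sum_{i=1}^m\mathbb{1}\{X_i=X_{m+r}\}$ and $C_{h(X_{m+r})}=\sum_{i=1}^m\mathbb{1}\{h(X_i)=h(X_{m+r})\}$. Then for all $c_1,c_2$ and all integers $l_1,l_2\geq0$, $$\Pr[f_{X_{m+1}}=l_1,f_{X_{m+2}}=l_2\mid C_{h(X_{m+1})}=c_1,C_{h(X_{m+2})}=c_2]=\frac{\mathrm{Num}(l_1,l_2,c_1,c_2)}{\mathrm{Den}(c_1,c_2)},$$ where $$\mathrm{Den}(c_1,c_2)=J\,\mathbb{1}\{c_1=c_2=c\}\frac{(\frac{\theta}{J})_{(c+2)}(\theta-\frac{\theta}{J})_{(m-c)}}{c!\,(m-c)!}+J(J-1)\frac{(\frac{\theta}{J})_{(c_1+1)}(\frac{\theta}{J})_{(c_2+1)}(\theta-\frac{2\theta}{J})_{(m-c_1-c_2)}}{c_1!\,c_2!\,(m-c_1-c_2)!},$$ $$\mathrm{Num}(l_1,l_2,c_1,c_2)=\mathbb{1}\{l_1=l_2=l,\,c_1=c_2=c\}\f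rac{\theta(l+1)(\frac{\theta}{J})_{(c-l)}(\theta-\frac{\theta}{J})_{(m-c)}}{(c-l)!\,(m-c)!}+\mathbb{1}\{c_1=c_2=c\}\frac{\theta^2(\frac{\theta}{J})_{(c-l_1-l_2)}(\theta-\frac{\theta}{J})_{(m-c)}}{J\,(c-l_1-l_2)!\,(m-c)!}+\frac{J-1}{J}\,\frac{\theta^2(\frac{\theta}{J})_{(c_1-l_1)}(\frac{\theta}{J})_{(c_2-l_2)}(\theta-\frac{2\theta}{J})_{(m-c_1-c_2)}}{(c_1-l_1)!\,(c_2-l_2)!\,(m-c_1-c_2)!}.$$
   Context: $(a)_{(n)}=\prod_{i=0}^{n-1}(a+i)$ is the rising factorial, $(a)_{(0)}=1$. The Dirichlet process $\mathrm{DP}(\theta,\nu)$ is the random probability measure $P=\sum_{j\geq1}P_j\delta_{Y_j}$ where $V_i$ are i.i.d. $\mathrm{Beta}(1,\theta)$, $P_1=V_1$, $P_j=V_j\prod_{i<j}(1-V_i)$, and $Y_j$ are i.i.d. from $\nu$ independent of the $V_i$. A perfectly random hash family means that for $h$ drawn from it, $(h(x))_{x\in\mathcal{V}}$ are i.i.d. uniform on $[J]=\{1,\ldots,J\}$. In the formulas, any term containing the factorial of a negative integer is interpreted as $0$.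
   Formalization: A family h(x) i.i.d. over a non-atomic space does not determine the law of h(X_i). Here h is given by labels at the atoms of P, so that given P and the X_i, hashes of distinct values are i.i.d. uniform. The diagonal of V×V is assumed measurable and the conditioning event of positive probability. *)

theory Defs
  imports "HOL-Probability.Probability"
begin

text \<open>pf a k = (a)_(k) / k!  for k >= 0, and 0 for k < 0 (term containing the
factorial of a negative integer is 0).\<close>
definition pf :: "real \<Rightarrow> int \<Rightarrow> real" where
  "pf a k = (if k < 0 then 0 else pochhammer a (nat k) / fact (nat k))"

definition Den :: "real \<Rightarrow> nat \<Rightarrow> nat \<Rightarrow> nat \<Rightarrow> nat \<Rightarrow> real" where
  "Den \<theta> J m c1 c2 =
     (let a = \<theta> / real J in
       (if c1 = c2 then real J * pochhammer a (c1 + 2) * pf (\<theta> - a) (int m - int c1) / fact c1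
        else 0)
       + real J * (real J - 1) * pochhammer a (c1 + 1) * pochhammer a (c2 + 1)
           * pf (\<theta> - 2 * a) (int m - int c1 - int c2) / (fact c1 * fact c2))"

definition Num :: "real \<Rightarrow> nat \<Rightarrow> nat \<Rightarrow> nat \<Rightarrow> nat \<Rightarrow> nat \<Rightarrow> nat \<Rightarrow> real" where
  "Num \<theta> J m l1 l2 c1 c2 =
     (let a = \<theta> / real J in
       (if l1 = l2 \<and> c1 = c2
        then \<theta> * (real l1 + 1) * pf a (int c1 - int l1) * pf (\<theta> - a) (int m - int c1)
        else 0)
       + (if c1 = c2
          then \<theta>\<^sup>2 / real J * pf a (int c1 - int l1 - int l2) * pf (\<theta> - a) (int m - int c1)
          else 0)
       + (real J - 1) / real J * \<theta>\<^sup>2 * pf a (int c1 - int l1) * pf a (int c2 - int l2)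
           * pf (\<theta> - 2 * a) (int m - int c1 - int c2))"

definition beta_measure :: "real \<Rightarrow> real \<Rightarrow> real measure" where
  "beta_measure a b = density lborel (\<lambda>x. ennreal
     (if 0 < x \<and> x < 1 then x powr (a - 1) * (1 - x) powr (b - 1) / Beta a b else 0))"

definition nonatomic :: "'v measure \<Rightarrow> bool" where
  "nonatomic \<nu> \<longleftrightarrow> (\<forall>A\<in>sets \<nu>. emeasure \<nu> A > 0 \<longrightarrow>
      (\<exists>B\<in>sets \<nu>. B \<subseteq> A \<and> 0 < emeasure \<nu> B \<and> emeasure \<nu> B < emeasure \<nu> A))"

text \<open>Sample space: (V_j)_j i.i.d. Beta(1,theta) (stick breaking), (Y_j)_j i.i.d. nu (atoms),
(U_i)_i i.i.d. Uniform(0,1) (used to draw X_i from P by inverse-cdf selection of an atom),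
(H_j)_j i.i.d. uniform on {1..J} (hash values attached to the atom locations).\<close>

type_synonym 'v omega = "(nat \<Rightarrow> real) \<times> (nat \<Rightarrow> 'v) \<times> (nat \<Rightarrow> real) \<times> (nat \<Rightarrow> nat)"

definition dp_model :: "'v measure \<Rightarrow> real \<Rightarrow> nat \<Rightarrow> 'v omega measure" where
  "dp_model \<nu> \<theta> J =
     (\<Pi>\<^sub>M j\<in>UNIV. beta_measure 1 \<theta>) \<Otimes>\<^sub>M
     ((\<Pi>\<^sub>M j\<in>UNIV. \<nu>) \<Otimes>\<^sub>M
     ((\<Pi>\<^sub>M i\<in>UNIV. uniform_measure lborel {0<..<1}) \<Otimes>\<^sub>M
      (\<Pi>\<^sub>M j\<in>UNIV. measure_pmf (pmf_of_set {1..J}))))"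

definition stick_weight :: "(nat \<Rightarrow> real) \<Rightarrow> nat \<Rightarrow> real" where
  "stick_weight v j = v j * (\<Prod>i<j. 1 - v i)"

text \<open>Index of the atom chosen by X_i: the least j with U_i < P_0 + ... + P_j,
so that, given P, the X_i are i.i.d. from P = sum_j P_j delta_{Y_j}.\<close>
definition atom_index :: "'v omega \<Rightarrow> nat \<Rightarrow> nat" where
  "atom_index \<omega> i = (case \<omega> of (v, y, u, hh) \<Rightarrow> (LEAST j. u i < (\<Sum>k\<le>j. stick_weight v k)))"

definition Xobs :: "'v omega \<Rightarrow> nat \<Rightarrow> 'v" where
  "Xobs \<omega> i = (case \<omega> of (v, y, u, hh) \<Rightarrow> y (atom_index \<omega> i))"

text \<open>The random hash function h : V -> [J]; its value at a location Y_j is H_j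
(on the locations of the atoms of P, which are the only points where h is evaluated).\<close>
definition hash :: "'v omega \<Rightarrow> 'v \<Rightarrow> nat" where
  "hash \<omega> x = (case \<omega> of (v, y, u, hh) \<Rightarrow> hh (LEAST j. y j = x))"

definition freq :: "nat \<Rightarrow> 'v omega \<Rightarrow> nat \<Rightarrow> nat" where
  "freq m \<omega> r = card {i\<in>{1..m}. Xobs \<omega> i = Xobs \<omega> (m + r)}"

definition bucket :: "nat \<Rightarrow> 'v omega \<Rightarrow> nat \<Rightarrow> nat" where
  "bucket m \<omega> r = card {i\<in>{1..m}. hash \<omega> (Xobs \<omega> i) = hash \<omega> (Xobs \<omega> (m + r))}"

definition cond_prob :: "'a measure \<Rightarrow> 'a set \<Rightarrow> 'a set \<Rightarrow> real" where
  "cond_prob M A B = measure M (A \<inter> B) / measure M B"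

end

theory Submission
  imports Defs
begin

text \<open>
Splitting off the first stick \<open>V\<^sub>0 ~ Beta(1, \<theta>)\<close> exhibits the atom indices of finitely many samples as a
self-similar family: a random subset \<open>S\<close> of the samples sits on atom \<open>0\<close>, and the remaining ones,
shifted by one, are distributed as before and independent of \<open>V\<^sub>0\<close>. The hash values of the atoms
split in the same way. Label every sample either as a member of a dedicated block (samples sharing one
atom, and nobody else does) with a prescribed hash value, or as a sample whose hash value lies in a
prescribed set. Summing over \<open>S\<close>, the probability of a labelling satisfies a recursion whose
unique solution is a product over the labels divided by \<open>(\<theta>)\<^sub>(\<^sub>n\<^sub>)\<close>: a dedicated block of size
\<open>k\<close> contributes \<open>\<alpha> (k - 1)!\<close>, a set label used \<open>k\<close> times contributes \<open>(\<alpha>)\<^sub>(\<^sub>k\<^sub>)\<close>, where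
\<open>\<alpha>\<close> is \<open>\<theta>\<close> times the probability of the hash values of the label. Both
events of the theorem are finite disjoint unions of such labellings, which are counted by
multinomial coefficients.
\<close>

section \<open>Stick breaking\<close>

text \<open>The empty \<open>S\<close> shapes the recursion. All \<open>n\<close> samples may avoid
  atom \<open>0\<close>, so the unknown probability returns on the right with the factor
  \<theta>/(\<theta> + n). For n > 0 this is below one and the equation can be solved, but only once
  the unknown is known to be finite, because the recursion lives in \<open>ennreal\<close>. The two
  kinds of label avoid a sum over all set partitions: only the atoms of the two new samples have to
  be resolved, and for every other sample the hash value is enough. The weights are classical. The
  points hashed into a set of mass \<alpha> carry, after normalisation, a Dirichlet process of total
  mass \<alpha>, which explains the Polya urn weight of a set label; a dedicated label has the
  weight of one block of the Ewens partition. The locations of the atoms matter only through ties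
  among them, which form a null set since \<nu> has no atoms. The common prefactor
  m!/(\<theta>)_(m+2) of both probabilities cancels in the quotient.\<close>

lemma sets_beta_measure [simp, measurable_cong]: "sets (beta_measure a b) = sets borel"
  by (simp add: beta_measure_def)

lemma space_beta_measure [simp]: "space (beta_measure a b) = UNIV"
  by (simp add: beta_measure_def)

text \<open>The integral is \<theta> times Beta(k + 1, l + \<theta>), the factor \<theta> being
  1/Beta(1, \<theta>); for natural \<open>k\<close> and \<open>l\<close> the Gamma quotients
  collapse to a factorial and rising factorials. It is the weight of \<open>k\<close> given samples
  choosing atom \<open>0\<close> while \<open>l\<close> others pass it by.\<close>

lemma nn_integral_beta_measure_1:
  assumes "0 < \<theta>"
  shows "(\<integral>\<^sup>+x. ennreal (x ^ k * (1 - x) ^ l) \<partial>beta_measure 1 \<theta>)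
    = ennreal (\<theta> * fact k * pochhammer \<theta> l / pochhammer \<theta> (k + l + 1))"
proof -
  let ?g = "\<lambda>x::real. indicator {0<..<1} x * (x powr (real k + 1 - 1) * (1 - x) powr (real l + \<theta> - 1))"
  have nonneg_int: "z \<notin> \<int>\<^sub>\<le>\<^sub>0" if "0 < z" for z :: real
    using that nonpos_Ints_nonpos by fastforce
  have Beta1: "Beta 1 \<theta> = 1 / \<theta>"
    using assms Gamma_plus1[OF nonneg_int[OF assms]] Gamma_real_pos[OF assms]
    by (simp add: Beta_def add.commute[of 1] less_imp_neq[symmetric])
  have Gadd: "Gamma (\<theta> + real n) = pochhammer \<theta> n * Gamma \<theta>" for n
    using pochhammer_Gamma[OF nonneg_int[OF assms], of n] Gamma_real_pos[OF assms] by (simp add: field_simps)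
  have Bkl: "Beta (real k + 1) (real l + \<theta>) = fact k * pochhammer \<theta> l / pochhammer \<theta> (k + l + 1)"
    using Gamma_fact[of k, where 'a = real] Gadd[of l] Gadd[of "k+l+1"] Gamma_real_pos[OF assms]
    by (simp add: Beta_def add_ac)
  have "((\<lambda>x. x powr (real k + 1 - 1) * (1 - x) powr (real l + \<theta> - 1)) has_integral Beta (real k + 1) (real l + \<theta>)) {0<..<1}"
    using has_integral_Beta_real[of "real k + 1" "real l + \<theta>"] assms by (simp add: has_integral_Icc_iff_Ioo)
  then have "((\<lambda>x. if x \<in> {0<..<1} then x powr (real k + 1 - 1) * (1 - x) powr (real l + \<theta> - 1) else 0)
      has_integral Beta (real k + 1) (real l + \<theta>)) UNIV"
    by (simp only: has_integral_restrict_UNIV)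
  also have "(\<lambda>x. if x \<in> {0<..<1} then x powr (real k + 1 - 1) * (1 - x) powr (real l + \<theta> - 1) else 0) = ?g"
    by (auto simp: indicator_def)
  finally have "(?g has_integral Beta (real k + 1) (real l + \<theta>)) UNIV" .
  then have I: "(\<integral>\<^sup>+x. ennreal (?g x) \<partial>lborel) = ennreal (Beta (real k + 1) (real l + \<theta>))"
    by (intro nn_integral_has_integral_lborel) auto
  have meas: "(\<lambda>x. ennreal (?g x)) \<in> borel_measurable lborel" by measurable
  have "(\<integral>\<^sup>+x. ennreal (x ^ k * (1 - x) ^ l) \<partial>beta_measure 1 \<theta>)
      = (\<integral>\<^sup>+x. ennreal \<theta> * ennreal (?g x) \<partial>lborel)"
    unfolding beta_measure_def using assms
    by (subst nn_integral_density)
       (auto intro!: nn_integral_cong simp: Beta1 indicator_def ennreal_mult'[symmetric] powr_diff powr_add powr_realpow field_simps)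
  also have "\<dots> = ennreal (\<theta> * Beta (real k + 1) (real l + \<theta>))"
    unfolding nn_integral_cmult[OF meas] I using assms by (simp add: ennreal_mult')
  finally show ?thesis by (simp add: Bkl mult.assoc)
qed

lemma prob_space_beta_measure_1: "0 < \<theta> \<Longrightarrow> prob_space (beta_measure 1 \<theta>)"
  using nn_integral_beta_measure_1[of \<theta> 0 0] by (intro prob_spaceI) simp

lemma AE_beta_measure: "AE x in beta_measure a b. 0 < x \<and> x < 1"
  unfolding beta_measure_def by (subst AE_density) auto

text \<open>An i.i.d. sequence is its first entry followed by an independent copy of itself. This
  self-similarity is applied to the sticks, to the hash values and to the atom locations.\<close>

lemma nn_integral_PiM_nat_split:
  fixes M :: "'a measure"
  assumes "prob_space M" and f [measurable]: "f \<in> borel_measurable (\<Pi>\<^sub>M i\<in>(UNIV::nat set). M)"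
  shows "(\<integral>\<^sup>+v. f v \<partial>(\<Pi>\<^sub>M i\<in>(UNIV::nat set). M))
    = (\<integral>\<^sup>+x. (\<integral>\<^sup>+v. f (case_nat x v) \<partial>(\<Pi>\<^sub>M i\<in>(UNIV::nat set). M)) \<partial>M)"
proof -
  interpret M: prob_space M by fact
  interpret P: sequence_space M by standard
  have "(\<integral>\<^sup>+v. f v \<partial>P.S) = (\<integral>\<^sup>+z. f (case z of (x, v) \<Rightarrow> case_nat x v) \<partial>(M \<Otimes>\<^sub>M P.S))"
    by (subst P.PiM_iter[symmetric], subst nn_integral_distr) auto
  also have "\<dots> = (\<integral>\<^sup>+x. \<integral>\<^sup>+v. f (case_nat x v) \<partial>P.S \<partial>M)"
    by (subst P.nn_integral_fst[symmetric]) auto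
  finally show ?thesis .
qed

section \<open>The stick weights sum to one almost surely\<close>

abbreviation sticks :: "real \<Rightarrow> (nat \<Rightarrow> real) measure" where
  "sticks \<theta> \<equiv> \<Pi>\<^sub>M j\<in>(UNIV::nat set). beta_measure 1 \<theta>"

lemma prob_space_sticks: "0 < \<theta> \<Longrightarrow> prob_space (sticks \<theta>)"
  by (intro prob_space_PiM prob_space_beta_measure_1)

lemma measurable_stick_weight [measurable]:
  "(\<lambda>v. stick_weight v j) \<in> borel_measurable (sticks \<theta>)"
  unfolding stick_weight_def by measurable

lemma stick_weight_0 [simp]: "stick_weight (case_nat x v) 0 = x"
  by (simp add: stick_weight_def)

lemma stick_weight_Suc [simp]: "stick_weight (case_nat x v) (Suc j) = (1 - x) * stick_weight v j"
  by (simp add: stick_weight_def prod.lessThan_Suc_shift del: prod.lessThan_Suc)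

lemma sum_stick_weight: "(\<Sum>k<n. stick_weight v k) = 1 - (\<Prod>k<n. 1 - v k)"
  by (induction n) (auto simp: stick_weight_def algebra_simps)

lemma AE_sticks_01:
  assumes "0 < \<theta>" shows "AE v in sticks \<theta>. \<forall>j. 0 < v j \<and> v j < 1"
proof -
  interpret B: prob_space "beta_measure 1 \<theta>" by (rule prob_space_beta_measure_1[OF assms])
  interpret P: sequence_space "beta_measure 1 \<theta>" by standard
  have "AE v in sticks \<theta>. 0 < v j \<and> v j < 1" for j
  proof -
    have "AE x in distr (sticks \<theta>) (beta_measure 1 \<theta>) (\<lambda>v. v j). 0 < x \<and> x < 1"
      by (subst P.PiM_component) (simp_all only: AE_beta_measure UNIV_I)
    then show ?thesis by (subst (asm) AE_distr_iff) auto
  qed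
  then show ?thesis by (simp add: AE_all_countable)
qed

text \<open>The leftover is a product of \<open>n\<close> independent factors \<open>1 - V\<close>,
  each of mean \<theta>/(\<theta> + 1), the case k = 0, l = 1 of the Beta moments.\<close>

lemma nn_integral_leftover:
  assumes "0 < \<theta>"
  shows "(\<integral>\<^sup>+v. ennreal (\<Prod>k<n. 1 - v k) \<partial>sticks \<theta>) = ennreal ((\<theta> / (\<theta> + 1)) ^ n)"
proof (induction n)
  case 0
  interpret prob_space "sticks \<theta>" by (rule prob_space_sticks[OF assms])
  show ?case by (simp add: emeasure_space_1)
next
  case (Suc n)
  have "(\<integral>\<^sup>+v. ennreal (\<Prod>k<Suc n. 1 - v k) \<partial>sticks \<theta>)
      = (\<integral>\<^sup>+x. (\<integral>\<^sup>+v. ennreal ((1 - x) * (\<Prod>k<n. 1 - v k)) \<partial>sticks \<theta>) \<partial>beta_measure 1 \<theta>)"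
    using assms by (subst nn_integral_PiM_nat_split)
      (auto simp: prob_space_beta_measure_1 prod.lessThan_Suc_shift simp del: prod.lessThan_Suc)
  also have "\<dots> = (\<integral>\<^sup>+x. ennreal (1 - x) * ennreal ((\<theta> / (\<theta> + 1)) ^ n) \<partial>beta_measure 1 \<theta>)"
    using AE_beta_measure
    by (intro nn_integral_cong_AE, eventually_elim)
       (auto simp: ennreal_mult' nn_integral_cmult Suc)
  also have "\<dots> = (\<integral>\<^sup>+x. ennreal (x^0 * (1 - x)^1) \<partial>beta_measure 1 \<theta>) * ennreal ((\<theta> / (\<theta> + 1)) ^ n)"
    by (subst nn_integral_multc) auto
  also have "\<dots> = ennreal ((\<theta> / (\<theta> + 1)) ^ Suc n)"
    unfolding nn_integral_beta_measure_1[OF assms] using assms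
    by (simp add: pochhammer_Suc ennreal_mult'[symmetric])
  finally show ?case .
qed

text \<open>The infimum of the leftovers is dominated by each of them, so its integral is below
  every (\<theta>/(\<theta> + 1))^n and vanishes; a decreasing sequence converges to its
  infimum.\<close>

lemma AE_leftover_tendsto_0:
  assumes "0 < \<theta>" shows "AE v in sticks \<theta>. (\<lambda>n. \<Prod>k<n. 1 - v k) \<longlonglongrightarrow> 0"
proof -
  let ?L = "\<lambda>v. INF n. ennreal (\<Prod>k<n. 1 - v k)"
  have "(\<integral>\<^sup>+v. ?L v \<partial>sticks \<theta>) \<le> ennreal ((\<theta> / (\<theta> + 1)) ^ n)" for n
    unfolding nn_integral_leftover[OF assms, symmetric] by (intro nn_integral_mono INF_lower) auto
  moreover have "(\<lambda>n. ennreal ((\<theta> / (\<theta> + 1)) ^ n)) \<longlonglongrightarrow> ennreal 0"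
    using assms by (intro tendsto_ennrealI LIMSEQ_realpow_zero) auto
  ultimately have "(\<integral>\<^sup>+v. ?L v \<partial>sticks \<theta>) \<le> 0"
    by (intro LIMSEQ_le_const[where X = "\<lambda>n. ennreal ((\<theta> / (\<theta> + 1)) ^ n)"]) auto
  then have "AE v in sticks \<theta>. ?L v = 0"
    by (subst nn_integral_0_iff_AE[symmetric]) auto
  with AE_sticks_01[OF assms] show ?thesis
  proof eventually_elim
    case (elim v)
    have "decseq (\<lambda>n. ennreal (\<Prod>k<n. 1 - v k))"
      unfolding prod.lessThan_Suc using elim
      by (intro decseq_SucI ennreal_leI) (simp add: mult_right_le_one_le prod_nonneg less_imp_le)
    from LIMSEQ_INF[OF this] elim have "(\<lambda>n. ennreal (\<Prod>k<n. 1 - v k)) \<longlonglongrightarrow> ennreal 0" by simp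
    then show ?case
      by (subst (asm) tendsto_ennreal_iff) (auto intro!: always_eventually prod_nonneg simp: elim less_imp_le)
  qed
qed

text \<open>The probability that every sample \<open>i\<close> in \<open>I\<close> selects atom
  \<open>\<kappa> i\<close>, written as a moment of the weights: given the sticks, the selections
  are independent.\<close>

definition atom_prob :: "real \<Rightarrow> 'i set \<Rightarrow> ('i \<Rightarrow> nat) \<Rightarrow> ennreal" where
  "atom_prob \<theta> I \<kappa> = (\<integral>\<^sup>+v. (\<Prod>i\<in>I. ennreal (stick_weight v (\<kappa> i))) \<partial>sticks \<theta>)"

text \<open>With first stick \<open>x\<close>, a sample in \<open>S\<close> contributes
  \<open>x\<close> and any other contributes \<open>1 - x\<close> times a weight of the shifted
  sequence. The powers of \<open>x\<close> and \<open>1 - x\<close> integrate to a Beta moment,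
  independently of the later sticks.\<close>

lemma atom_prob_split:
  assumes "0 < \<theta>" "finite I" "S \<subseteq> I" "\<And>i. i \<in> S \<Longrightarrow> \<kappa> i = 0" "\<And>i. i \<in> I - S \<Longrightarrow> \<kappa> i = Suc (\<kappa>' i)"
  shows "atom_prob \<theta> I \<kappa> = ennreal (\<theta> * fact (card S) * pochhammer \<theta> (card (I - S)) / pochhammer \<theta> (card I + 1))
    * atom_prob \<theta> (I - S) \<kappa>'"
proof -
  have card: "card I = card S + card (I - S)"
    using assms by (simp add: card_Diff_subset card_mono finite_subset)
  have "atom_prob \<theta> I \<kappa> = (\<integral>\<^sup>+x. (\<integral>\<^sup>+v. (\<Prod>i\<in>I. ennreal (stick_weight (case_nat x v) (\<kappa> i))) \<partial>sticks \<theta>) \<partial>beta_measure 1 \<theta>)"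
    unfolding atom_prob_def using assms(1) by (subst nn_integral_PiM_nat_split) (auto simp: prob_space_beta_measure_1)
  also have "\<dots> = (\<integral>\<^sup>+x. ennreal (x ^ card S * (1 - x) ^ card (I - S)) * atom_prob \<theta> (I - S) \<kappa>' \<partial>beta_measure 1 \<theta>)"
    using AE_beta_measure
  proof (intro nn_integral_cong_AE, eventually_elim)
    fix x :: real assume x: "0 < x \<and> x < 1"
    have "(\<Prod>i\<in>I. ennreal (stick_weight (case_nat x v) (\<kappa> i)))
      = ennreal (x ^ card S * (1 - x) ^ card (I - S)) * (\<Prod>i\<in>I - S. ennreal (stick_weight v (\<kappa>' i)))" for v
      using assms x
      by (subst prod.subset_diff[OF assms(3,2)])
         (simp add: ennreal_mult' prod.distrib ennreal_power mult_ac)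
    then show "(\<integral>\<^sup>+v. (\<Prod>i\<in>I. ennreal (stick_weight (case_nat x v) (\<kappa> i))) \<partial>sticks \<theta>)
        = ennreal (x ^ card S * (1 - x) ^ card (I - S)) * atom_prob \<theta> (I - S) \<kappa>'"
      by (simp add: atom_prob_def nn_integral_cmult)
  qed
  also have "\<dots> = ennreal (\<theta> * fact (card S) * pochhammer \<theta> (card (I - S)) / pochhammer \<theta> (card I + 1))
    * atom_prob \<theta> (I - S) \<kappa>'"
    by (subst nn_integral_multc) (auto simp: nn_integral_beta_measure_1[OF assms(1)] card)
  finally show ?thesis .
qed

section \<open>Atom indices of finitely many samples\<close>

text \<open>The selection rule of \<open>atom_index\<close> as a function of one stick sequence and
  one uniform variable, so that the sticks can be held fixed while the uniforms vary.\<close>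

definition stick_index :: "(nat \<Rightarrow> real) \<Rightarrow> real \<Rightarrow> nat" where
  "stick_index v x = (LEAST j. x < (\<Sum>k\<le>j. stick_weight v k))"

abbreviation unif01 :: "real measure" where
  "unif01 \<equiv> uniform_measure lborel {0<..<1}"

abbreviation unifs :: "(nat \<Rightarrow> real) measure" where
  "unifs \<equiv> \<Pi>\<^sub>M i\<in>(UNIV::nat set). unif01"

lemma prob_space_unif01: "prob_space unif01"
  by (intro prob_space_uniform_measure) auto

lemma measurable_stick_index [measurable (raw)]:
  assumes [measurable]: "f \<in> measurable M (sticks \<theta>)" "g \<in> borel_measurable M"
  shows "(\<lambda>x. stick_index (f x) (g x)) \<in> measurable M (count_space UNIV)"
  unfolding stick_index_def by measurable

text \<open>The partial sums of the weights increase from 0 to 1, so the half-open intervals between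
  consecutive ones tile the unit interval, and the least index picks the tile containing
  \<open>x\<close>.\<close>

lemma stick_index_eq_iff:
  assumes v: "\<And>j. 0 < v j \<and> v j < 1" "(\<lambda>n. \<Prod>k<n. 1 - v k) \<longlonglongrightarrow> 0" and x: "0 < x" "x < 1"
  shows "stick_index v x = j \<longleftrightarrow> (\<Sum>k<j. stick_weight v k) \<le> x \<and> x < (\<Sum>k<Suc j. stick_weight v k)"
proof -
  let ?s = "\<lambda>n. \<Sum>k<n. stick_weight v k"
  have pos: "0 \<le> stick_weight v k" for k
    using v by (auto simp: stick_weight_def less_imp_le intro!: mult_nonneg_nonneg prod_nonneg)
  have mono: "mono ?s"
    by (intro incseq_SucI) (simp add: pos)
  have "?s \<longlonglongrightarrow> 1 - 0"
    unfolding sum_stick_weight by (intro tendsto_diff tendsto_const v(2))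
  \<comment> \<open>Here the vanishing leftover enters: it provides some partial sum above
    \<open>x\<close>, without which \<open>LEAST\<close> would have no specified value.\<close>
  then have "eventually (\<lambda>n. x < ?s n) sequentially"
    using x by (intro order_tendstoD) auto
  then obtain n where "x < ?s n" by (auto simp: eventually_sequentially)
  then have ex: "\<exists>j. x < ?s (Suc j)"
    using pos[of n] by (intro exI[of _ n]) simp
  have idx: "stick_index v x = (LEAST j. x < ?s (Suc j))"
    by (simp add: stick_index_def lessThan_Suc_atMost)
  show ?thesis
  proof
    assume j: "stick_index v x = j"
    have "x < ?s (Suc j)" using LeastI_ex[OF ex] j idx by simp
    moreover have "?s j \<le> x"
    proof (cases j)
      case (Suc i)
      then have "\<not> x < ?s (Suc i)" using j idx not_less_Least[of i "\<lambda>j. x < ?s (Suc j)"] by simp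
      then show ?thesis using Suc by simp
    qed (use x in auto)
    ultimately show "?s j \<le> x \<and> x < ?s (Suc j)" by simp
  next
    assume j: "?s j \<le> x \<and> x < ?s (Suc j)"
    have "j \<le> i" if "x < ?s (Suc i)" for i
    proof (rule ccontr)
      assume "\<not> j \<le> i"
      then have "?s (Suc i) \<le> ?s j" by (intro monoD[OF mono]) simp
      with that j show False by linarith
    qed
    with j show "stick_index v x = j" unfolding idx by (intro Least_equality) auto
  qed
qed

lemma emeasure_stick_index:
  assumes v: "\<And>j. 0 < v j \<and> v j < 1" "(\<lambda>n. \<Prod>k<n. 1 - v k) \<longlonglongrightarrow> 0"
  shows "emeasure unif01 {x. stick_index v x = j} = ennreal (stick_weight v j)"
proof -
  let ?s = "\<lambda>n. \<Sum>k<n. stick_weight v k"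
  let ?A = "{x. stick_index v x = j}"
  have sets_A [measurable]: "?A \<in> sets lborel"
    unfolding stick_index_def by measurable
  have A: "{0<..<1} \<inter> ?A = {0<..<1} \<inter> {?s j..<?s (Suc j)}"
    by (intro set_eqI) (simp add: stick_index_eq_iff[OF v, of _ j] cong: conj_cong del: sum.lessThan_Suc)
  have prod01: "0 < (\<Prod>k<n. 1 - v k)" "(\<Prod>k<n. 1 - v k) \<le> 1" for n
    using v(1) by (auto intro!: prod_pos prod_le_1 simp: less_imp_le)
  have s01: "0 \<le> ?s n" "?s n < 1" for n
    unfolding sum_stick_weight using prod01[of n] by simp_all
  have w: "0 \<le> stick_weight v j"
    using v by (auto simp: stick_weight_def less_imp_le intro!: mult_nonneg_nonneg prod_nonneg)
  \<comment> \<open>The intersection is the half-open tile, except that for \<open>j = 0\<close> it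
    also loses the point 0. Squeezing it between the open and the closed interval of the same length
    makes the endpoints irrelevant.\<close>
  have "emeasure lborel ({0<..<1} \<inter> ?A) = ennreal (stick_weight v j)"
  proof (rule antisym)
    have "emeasure lborel ({0<..<1} \<inter> ?A) \<le> emeasure lborel {?s j..?s (Suc j)}"
      unfolding A by (intro emeasure_mono) auto
    also have "\<dots> = ennreal (stick_weight v j)" using w by (subst emeasure_lborel_Icc) auto
    finally show "emeasure lborel ({0<..<1} \<inter> ?A) \<le> ennreal (stick_weight v j)" .
    have "ennreal (stick_weight v j) = emeasure lborel {?s j<..<?s (Suc j)}"
      using w by (subst emeasure_lborel_Ioo) auto
    also have "\<dots> \<le> emeasure lborel ({0<..<1} \<inter> ?A)"
    proof (intro emeasure_mono)
      show "{?s j<..<?s (Suc j)} \<subseteq> {0<..<1} \<inter> ?A"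
        unfolding A using s01(1)[of j] s01(2)[of "Suc j"] by (auto simp del: sum.lessThan_Suc)
    qed measurable
    finally show "ennreal (stick_weight v j) \<le> emeasure lborel ({0<..<1} \<inter> ?A)" .
  qed
  then show ?thesis by (simp add: emeasure_uniform_measure[OF _ sets_A] divide_ennreal_def)
qed

text \<open>The exceptional null set consists of bad stick sequences only, so one null set serves
  every \<open>\<kappa>\<close>. For a good sequence the uniforms are independent and each factor is
  the length of a tile.\<close>

lemma AE_emeasure_stick_indices:
  fixes I :: "nat set"
  assumes "0 < \<theta>" "finite I"
  shows "AE v in sticks \<theta>. \<forall>\<kappa>. emeasure unifs {u \<in> space unifs. \<forall>i\<in>I. stick_index v (u i) = \<kappa> i}
    = (\<Prod>i\<in>I. ennreal (stick_weight v (\<kappa> i)))"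
  using AE_sticks_01[OF assms(1)] AE_leftover_tendsto_0[OF assms(1)]
proof eventually_elim
  case (elim v)
  interpret U: prob_space unif01 by (rule prob_space_unif01)
  interpret P: product_prob_space "\<lambda>_. unif01" "UNIV::nat set" by standard
  show ?case
  proof
    fix \<kappa> :: "nat \<Rightarrow> nat"
    have "{x. stick_index v x = \<kappa> i} \<in> sets unif01" for i
      unfolding stick_index_def by measurable
    from P.emeasure_PiM_Collect[of I "\<lambda>i. {x. stick_index v x = \<kappa> i}", OF _ assms(2) this]
    show "emeasure unifs {u \<in> space unifs. \<forall>i\<in>I. stick_index v (u i) = \<kappa> i}
      = (\<Prod>i\<in>I. ennreal (stick_weight v (\<kappa> i)))"
      using emeasure_stick_index[OF elim(1)[rule_format] elim(2)] by simp
  qed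
qed

lemma emeasure_stick_indices:
  fixes I :: "nat set"
  assumes "0 < \<theta>" "finite I"
  shows "emeasure (sticks \<theta> \<Otimes>\<^sub>M unifs)
    {z \<in> space (sticks \<theta> \<Otimes>\<^sub>M unifs). \<forall>i\<in>I. stick_index (fst z) (snd z i) = \<kappa> i} = atom_prob \<theta> I \<kappa>"
proof -
  interpret U: prob_space unifs by (intro prob_space_PiM prob_space_unif01)
  let ?A = "{z \<in> space (sticks \<theta> \<Otimes>\<^sub>M unifs). \<forall>i\<in>I. stick_index (fst z) (snd z i) = \<kappa> i}"
  have [measurable]: "?A \<in> sets (sticks \<theta> \<Otimes>\<^sub>M unifs)"
    using assms(2) by measurable
  have "emeasure (sticks \<theta> \<Otimes>\<^sub>M unifs) ?A = (\<integral>\<^sup>+v. emeasure unifs (Pair v -` ?A) \<partial>sticks \<theta>)"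
    by (rule U.emeasure_pair_measure_alt) measurable
  also have "\<dots> = atom_prob \<theta> I \<kappa>"
    unfolding atom_prob_def using AE_emeasure_stick_indices[OF assms]
  proof (intro nn_integral_cong_AE, eventually_elim)
    case (elim v)
    have "Pair v -` ?A = {u \<in> space unifs. \<forall>i\<in>I. stick_index v (u i) = \<kappa> i}"
      by (auto simp: space_pair_measure space_PiM)
    with elim show ?case by simp
  qed
  finally show ?thesis .
qed

text \<open>Distinct assignments describe disjoint events of a probability space. The bound supplies
  the finiteness needed to solve the recursion in the reals.\<close>

lemma sum_atom_prob_le_1:
  fixes I :: "nat set"
  assumes "0 < \<theta>" "finite I"
  shows "(\<integral>\<^sup>+\<kappa>. atom_prob \<theta> I \<kappa> \<partial>count_space (I \<rightarrow>\<^sub>E UNIV)) \<le> 1"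
proof -
  interpret V: prob_space "sticks \<theta>" by (rule prob_space_sticks[OF assms(1)])
  interpret U: prob_space unifs by (intro prob_space_PiM prob_space_unif01)
  interpret VU: pair_prob_space "sticks \<theta>" unifs ..
  let ?A = "\<lambda>\<kappa>. {z \<in> space (sticks \<theta> \<Otimes>\<^sub>M unifs). \<forall>i\<in>I. stick_index (fst z) (snd z i) = \<kappa> i}"
  have [measurable]: "?A \<kappa> \<in> sets (sticks \<theta> \<Otimes>\<^sub>M unifs)" for \<kappa>
    using assms(2) by measurable
  have "disjoint_family_on ?A (I \<rightarrow>\<^sub>E UNIV)"
    unfolding disjoint_family_on_def
  proof safe
    fix \<kappa> \<kappa>' z assume "\<kappa> \<in> I \<rightarrow>\<^sub>E UNIV" "\<kappa>' \<in> I \<rightarrow>\<^sub>E UNIV" "\<kappa> \<noteq> \<kappa>'"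
      "\<forall>i\<in>I. stick_index (fst z) (snd z i) = \<kappa> i" "\<forall>i\<in>I. stick_index (fst z) (snd z i) = \<kappa>' i"
    then show "z \<in> {}" by (metis PiE_ext)
  qed
  then have "(\<integral>\<^sup>+\<kappa>. atom_prob \<theta> I \<kappa> \<partial>count_space (I \<rightarrow>\<^sub>E UNIV)) =
      emeasure (sticks \<theta> \<Otimes>\<^sub>M unifs) (\<Union>\<kappa>\<in>I \<rightarrow>\<^sub>E UNIV. ?A \<kappa>)"
    using assms(2)
    by (subst emeasure_UN_countable) (auto simp: emeasure_stick_indices[OF assms] intro!: countable_PiE)
  also have "\<dots> \<le> 1" by (rule VU.emeasure_le_1)
  finally show ?thesis .
qed

section \<open>The recursion for labellings\<close>

abbreviation hashes :: "'h pmf \<Rightarrow> (nat \<Rightarrow> 'h) measure" where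
  "hashes H \<equiv> \<Pi>\<^sub>M j\<in>(UNIV::nat set). measure_pmf H"

definition hash_prob :: "'h pmf \<Rightarrow> 'i set \<Rightarrow> ('i \<Rightarrow> 'h set) \<Rightarrow> ('i \<Rightarrow> nat) \<Rightarrow> ennreal" where
  "hash_prob H I T \<kappa> = emeasure (hashes H) {h \<in> space (hashes H). \<forall>i\<in>I. h (\<kappa> i) \<in> T i}"

lemma space_hashes [simp]: "space (hashes H) = UNIV"
  by (simp add: space_PiM)

lemma pred_hashes [measurable]: "Measurable.pred (hashes H) (\<lambda>h. h j \<in> A)"
  by (rule pred_sets2[of A "measure_pmf H"]) auto

text \<open>All samples in \<open>S\<close> read the same hash value, that of atom \<open>0\<close>,
  which must therefore satisfy all their constraints at once; the others read the shifted,
  independent sequence. For empty \<open>S\<close> the intersection is \<open>UNIV\<close> and the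
  factor is one.\<close>

lemma hash_prob_split:
  assumes "finite I" "S \<subseteq> I" "\<And>i. i \<in> S \<Longrightarrow> \<kappa> i = 0" "\<And>i. i \<in> I - S \<Longrightarrow> \<kappa> i = Suc (\<kappa>' i)"
  shows "hash_prob H I T \<kappa> = emeasure (measure_pmf H) (\<Inter>i\<in>S. T i) * hash_prob H (I - S) T \<kappa>'"
proof -
  let ?A = "\<lambda>I \<kappa>. {h \<in> space (hashes H). \<forall>i\<in>I. h (\<kappa> i) \<in> T i}"
  have meas [measurable]: "?A I \<kappa> \<in> sets (hashes H)" if "finite I" for I \<kappa>
    using that by measurable
  note [measurable] = meas[OF assms(1)] meas[OF finite_Diff[OF assms(1)], of S]
  have split: "indicator (?A I \<kappa>) (case_nat x h)
      = (indicator (\<Inter>i\<in>S. T i) x * indicator (?A (I - S) \<kappa>') h :: ennreal)" for x h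
  proof -
    have "(\<forall>i\<in>I. case_nat x h (\<kappa> i) \<in> T i) \<longleftrightarrow> (\<forall>i\<in>S. x \<in> T i) \<and> (\<forall>i\<in>I - S. h (\<kappa>' i) \<in> T i)"
    proof -
      have "(\<forall>i\<in>I. case_nat x h (\<kappa> i) \<in> T i) \<longleftrightarrow> (\<forall>i\<in>S \<union> (I - S). case_nat x h (\<kappa> i) \<in> T i)"
        using assms(2) by (simp add: Un_absorb1)
      then show ?thesis by (simp add: ball_Un assms(3,4) del: Un_Diff_cancel Un_Diff_cancel2)
    qed
    then show ?thesis by (auto simp: indicator_def)
  qed
  have "hash_prob H I T \<kappa> = (\<integral>\<^sup>+h. indicator (?A I \<kappa>) h \<partial>hashes H)"
    unfolding hash_prob_def by (rule nn_integral_indicator[symmetric]) (rule meas[OF assms(1)])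
  also have "\<dots> = (\<integral>\<^sup>+x. \<integral>\<^sup>+h. indicator (?A I \<kappa>) (case_nat x h) \<partial>hashes H \<partial>measure_pmf H)"
    by (rule nn_integral_PiM_nat_split[OF measure_pmf.prob_space_axioms]) measurable
  also have "\<dots> = (\<integral>\<^sup>+x. indicator (\<Inter>i\<in>S. T i) x * emeasure (hashes H) (?A (I - S) \<kappa>') \<partial>measure_pmf H)"
    unfolding split using meas[OF finite_Diff[OF assms(1)], of S \<kappa>']
    by (subst nn_integral_cmult) (simp_all del: space_hashes)
  also have "\<dots> = emeasure (measure_pmf H) (\<Inter>i\<in>S. T i) * hash_prob H (I - S) T \<kappa>'"
    unfolding hash_prob_def by (subst nn_integral_multc) auto
  finally show ?thesis .
qed

text \<open>A label in \<open>D\<close> is dedicated: the indices carrying it form a whole block of the partition by atoms.\<close>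

definition label_compat :: "'l set \<Rightarrow> ('i \<Rightarrow> 'l) \<Rightarrow> 'i set \<Rightarrow> ('i \<Rightarrow> nat) \<Rightarrow> bool" where
  "label_compat D \<sigma> I \<kappa> \<longleftrightarrow> (\<forall>i\<in>I. \<forall>i'\<in>I. \<sigma> i \<in> D \<longrightarrow> (\<kappa> i = \<kappa> i' \<longleftrightarrow> \<sigma> i = \<sigma> i'))"

text \<open>The probability that the samples realise the labelling, expanded over their atom
  assignments: compatibility depends on \<open>\<kappa>\<close> alone, and atom selection is
  independent of the hash values.\<close>

definition label_sum :: "real \<Rightarrow> 'h pmf \<Rightarrow> 'l set \<Rightarrow> ('l \<Rightarrow> 'h set) \<Rightarrow> ('i \<Rightarrow> 'l) \<Rightarrow> 'i set \<Rightarrow> ennreal" where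
  "label_sum \<theta> H D T \<sigma> I = (\<integral>\<^sup>+\<kappa>. indicator {\<kappa>. label_compat D \<sigma> I \<kappa>} \<kappa> *
     (atom_prob \<theta> I \<kappa> * hash_prob H I (\<lambda>i. T (\<sigma> i)) \<kappa>) \<partial>count_space (I \<rightarrow>\<^sub>E UNIV))"

text \<open>The sets \<open>S\<close> that may be the set of indices on atom \<open>0\<close>.\<close>

definition zero_ok :: "'l set \<Rightarrow> ('i \<Rightarrow> 'l) \<Rightarrow> 'i set \<Rightarrow> 'i set \<Rightarrow> bool" where
  "zero_ok D \<sigma> I S \<longleftrightarrow> (\<forall>i\<in>S. \<forall>i'\<in>I. \<sigma> i \<in> D \<or> \<sigma> i' \<in> D \<longrightarrow> (i' \<in> S \<longleftrightarrow> \<sigma> i = \<sigma> i'))"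

lemma nn_integral_count_space_partition:
  assumes "finite \<P>" "B = (\<Union>S\<in>\<P>. Z S)" "disjoint_family_on Z \<P>"
  shows "(\<integral>\<^sup>+x. f x \<partial>count_space B) = (\<Sum>S\<in>\<P>. \<integral>\<^sup>+x. f x \<partial>count_space (Z S))"
proof -
  have "(\<integral>\<^sup>+x. f x \<partial>count_space B) = (\<integral>\<^sup>+x. f x * indicator B x \<partial>count_space UNIV)"
    by (simp add: nn_integral_count_space_indicator)
  also have "\<dots> = (\<integral>\<^sup>+x. (\<Sum>S\<in>\<P>. f x * indicator (Z S) x) \<partial>count_space UNIV)"
    unfolding assms(2) by (simp add: indicator_UN_disjoint[OF assms(1,3)] sum_distrib_left)
  also have "\<dots> = (\<Sum>S\<in>\<P>. \<integral>\<^sup>+x. f x * indicator (Z S) x \<partial>count_space UNIV)"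
    by (rule nn_integral_sum) simp
  also have "\<dots> = (\<Sum>S\<in>\<P>. \<integral>\<^sup>+x. f x \<partial>count_space (Z S))"
    by (simp add: nn_integral_count_space_indicator)
  finally show ?thesis .
qed

text \<open>The assignments are sorted by the set \<open>S\<close> of samples on atom
  \<open>0\<close>. For fixed \<open>S\<close>, lowering the remaining indices by one is a bijection
  onto the assignments of \<open>I - S\<close>, under which atom weight, hash weight and
  compatibility all factor.\<close>

lemma label_sum_split:
  assumes "0 < \<theta>" "finite I"
  shows "label_sum \<theta> H D T \<sigma> I = (\<Sum>S\<in>Pow I. of_bool (zero_ok D \<sigma> I S) *
    (ennreal (\<theta> * fact (card S) * pochhammer \<theta> (card (I - S)) / pochhammer \<theta> (card I + 1)) *
     emeasure (measure_pmf H) (\<Inter>i\<in>S. T (\<sigma> i))) * label_sum \<theta> H D T \<sigma> (I - S))"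
proof -
  let ?Z = "\<lambda>S. {\<kappa> \<in> I \<rightarrow>\<^sub>E UNIV. \<forall>i\<in>I. \<kappa> i = (0::nat) \<longleftrightarrow> i \<in> S}"
  let ?f = "\<lambda>\<kappa>. indicator {\<kappa>. label_compat D \<sigma> I \<kappa>} \<kappa> * (atom_prob \<theta> I \<kappa> * hash_prob H I (\<lambda>i. T (\<sigma> i)) \<kappa>)"
  have *: "(\<integral>\<^sup>+\<kappa>. ?f \<kappa> \<partial>count_space (?Z S)) = of_bool (zero_ok D \<sigma> I S) *
    (ennreal (\<theta> * fact (card S) * pochhammer \<theta> (card (I - S)) / pochhammer \<theta> (card I + 1)) *
     emeasure (measure_pmf H) (\<Inter>i\<in>S. T (\<sigma> i))) * label_sum \<theta> H D T \<sigma> (I - S)"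
    if S: "S \<subseteq> I" for S
  proof -
    \<comment> \<open>The inverse shift: \<open>S\<close> goes to atom \<open>0\<close>, the rest
      moves up by one, and \<open>undefined\<close> outside \<open>I\<close> keeps the result
      extensional.\<close>
    define g where "g = (\<lambda>\<kappa>' i. if i \<in> I - S then Suc (\<kappa>' i) else if i \<in> S then 0 else undefined)"
    have bij: "bij_betw g ((I - S) \<rightarrow>\<^sub>E UNIV) (?Z S)"
    proof (rule bij_betwI[where g = "\<lambda>\<kappa>. restrict (\<lambda>i. \<kappa> i - 1) (I - S)"])
      show "g \<in> ((I - S) \<rightarrow>\<^sub>E UNIV) \<rightarrow> ?Z S"
        using S by (auto simp: g_def PiE_def extensional_def split: if_splits)
      show "(\<lambda>\<kappa>. restrict (\<lambda>i. \<kappa> i - 1) (I - S)) \<in> ?Z S \<rightarrow> ((I - S) \<rightarrow>\<^sub>E UNIV)"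
        by auto
      show "restrict (\<lambda>i. g \<kappa>' i - 1) (I - S) = \<kappa>'" if "\<kappa>' \<in> (I - S) \<rightarrow>\<^sub>E UNIV" for \<kappa>'
        using that by (auto simp: g_def fun_eq_iff PiE_def extensional_def)
      show "g (restrict (\<lambda>i. \<kappa> i - 1) (I - S)) = \<kappa>" if "\<kappa> \<in> ?Z S" for \<kappa>
        using that S by (auto simp: g_def fun_eq_iff PiE_def extensional_def)
    qed
    \<comment> \<open>Pairs meeting \<open>S\<close> yield \<open>zero_ok\<close>, pairs outside
      \<open>S\<close> yield compatibility of the rest. A pair can be read in both orders, whence
      the disjunction in \<open>zero_ok\<close>.\<close>
    have compat: "label_compat D \<sigma> I (g \<kappa>') \<longleftrightarrow> zero_ok D \<sigma> I S \<and> label_compat D \<sigma> (I - S) \<kappa>'" for \<kappa>'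
    proof -
      have g: "g \<kappa>' i = g \<kappa>' i' \<longleftrightarrow> (if i \<in> S then i' \<in> S else i' \<notin> S \<and> \<kappa>' i = \<kappa>' i')"
        if "i \<in> I" "i' \<in> I" for i i'
        using that by (auto simp: g_def)
      show ?thesis
      proof
        assume c: "label_compat D \<sigma> I (g \<kappa>')"
        have "i' \<in> S \<longleftrightarrow> \<sigma> i = \<sigma> i'" if "i \<in> S" "i' \<in> I" "\<sigma> i \<in> D \<or> \<sigma> i' \<in> D" for i i'
          using c[unfolded label_compat_def, rule_format, of i i'] c[unfolded label_compat_def, rule_format, of i' i]
            g[of i i'] g[of i' i] that S by auto
        moreover have "\<kappa>' i = \<kappa>' i' \<longleftrightarrow> \<sigma> i = \<sigma> i'" if "i \<in> I - S" "i' \<in> I - S" "\<sigma> i \<in> D" for i i'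
          using c[unfolded label_compat_def, rule_format, of i i'] g[of i i'] that by auto
        ultimately show "zero_ok D \<sigma> I S \<and> label_compat D \<sigma> (I - S) \<kappa>'"
          by (simp add: zero_ok_def label_compat_def)
      next
        assume c: "zero_ok D \<sigma> I S \<and> label_compat D \<sigma> (I - S) \<kappa>'"
        have "g \<kappa>' i = g \<kappa>' i' \<longleftrightarrow> \<sigma> i = \<sigma> i'" if i: "i \<in> I" "i' \<in> I" "\<sigma> i \<in> D" for i i'
          using c[THEN conjunct1, unfolded zero_ok_def, rule_format, of i i']
            c[THEN conjunct1, unfolded zero_ok_def, rule_format, of i' i]
            c[THEN conjunct2, unfolded label_compat_def, rule_format, of i i'] g[of i i'] i
          by (cases "i \<in> S"; cases "i' \<in> S") auto
        then show "label_compat D \<sigma> I (g \<kappa>')"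
          by (simp add: label_compat_def)
      qed
    qed
    have "(\<integral>\<^sup>+\<kappa>. ?f \<kappa> \<partial>count_space (?Z S)) = (\<integral>\<^sup>+\<kappa>'. ?f (g \<kappa>') \<partial>count_space ((I - S) \<rightarrow>\<^sub>E UNIV))"
      by (rule nn_integral_bij_count_space[OF bij, symmetric])
    also have "\<dots> = (\<integral>\<^sup>+\<kappa>'. (of_bool (zero_ok D \<sigma> I S) *
      (ennreal (\<theta> * fact (card S) * pochhammer \<theta> (card (I - S)) / pochhammer \<theta> (card I + 1)) *
        emeasure (measure_pmf H) (\<Inter>i\<in>S. T (\<sigma> i)))) *
       (indicator {\<kappa>. label_compat D \<sigma> (I - S) \<kappa>} \<kappa>' * (atom_prob \<theta> (I - S) \<kappa>' * hash_prob H (I - S) (\<lambda>i. T (\<sigma> i)) \<kappa>'))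
       \<partial>count_space ((I - S) \<rightarrow>\<^sub>E UNIV))"
    proof (intro nn_integral_cong, goal_cases)
      case (1 \<kappa>')
      have g: "\<And>i. i \<in> S \<Longrightarrow> g \<kappa>' i = 0" "\<And>i. i \<in> I - S \<Longrightarrow> g \<kappa>' i = Suc (\<kappa>' i)"
        by (auto simp: g_def)
      have "atom_prob \<theta> I (g \<kappa>') = ennreal (\<theta> * fact (card S) * pochhammer \<theta> (card (I - S)) / pochhammer \<theta> (card I + 1)) * atom_prob \<theta> (I - S) \<kappa>'"
        by (rule atom_prob_split[OF assms S]) (auto simp: g)
      moreover have "hash_prob H I (\<lambda>i. T (\<sigma> i)) (g \<kappa>') = emeasure (measure_pmf H) (\<Inter>i\<in>S. T (\<sigma> i)) * hash_prob H (I - S) (\<lambda>i. T (\<sigma> i)) \<kappa>'"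
        by (rule hash_prob_split[OF assms(2) S]) (auto simp: g)
      ultimately show ?case
        by (simp add: compat mult_ac split: split_indicator)
    qed
    also have "\<dots> = (of_bool (zero_ok D \<sigma> I S) *
      (ennreal (\<theta> * fact (card S) * pochhammer \<theta> (card (I - S)) / pochhammer \<theta> (card I + 1)) *
        emeasure (measure_pmf H) (\<Inter>i\<in>S. T (\<sigma> i)))) * label_sum \<theta> H D T \<sigma> (I - S)"
      unfolding label_sum_def by (rule nn_integral_cmult) simp
    finally show ?thesis .
  qed
  have "label_sum \<theta> H D T \<sigma> I = (\<Sum>S\<in>Pow I. \<integral>\<^sup>+\<kappa>. ?f \<kappa> \<partial>count_space (?Z S))"
    unfolding label_sum_def
  proof (rule nn_integral_count_space_partition)
    show "I \<rightarrow>\<^sub>E UNIV = (\<Union>S\<in>Pow I. ?Z S)"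
    proof (intro set_eqI iffI)
      fix \<kappa> assume "\<kappa> \<in> I \<rightarrow>\<^sub>E (UNIV :: nat set)"
      then show "\<kappa> \<in> (\<Union>S\<in>Pow I. ?Z S)"
        by (intro UN_I[of "{i\<in>I. \<kappa> i = 0}"]) auto
    qed auto
    show "disjoint_family_on ?Z (Pow I)"
      by (auto simp: disjoint_family_on_def)
  qed (use assms in auto)
  also note sum.cong[OF refl *[OF PowD]]
  finally show ?thesis .
qed

section \<open>Rising factorial identities and the solution of the recursion\<close>

lemma sum_Pow_card:
  assumes "finite A"
  shows "(\<Sum>S\<in>Pow A. f (card S)) = (\<Sum>k\<le>card A. of_nat (card A choose k) * (f k :: 'a :: semiring_1))"
proof -
  have "(\<Sum>S\<in>Pow A. f (card S)) = (\<Sum>k\<le>card A. \<Sum>S\<in>{S \<in> Pow A. card S = k}. f (card S))"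
    using assms by (intro sum.group[symmetric]) (auto intro: card_mono)
  also have "\<dots> = (\<Sum>k\<le>card A. of_nat (card A choose k) * f k)"
    using assms by (intro sum.cong refl) (simp add: n_subsets)
  finally show ?thesis .
qed

text \<open>Counting permutations of \<open>n + 1\<close> points with weight \<open>a\<close> per
  cycle: \<open>k\<close> is the number of other points in the cycle of a marked point. The
  induction peels off \<open>k = 0\<close> and absorbs a factor \<open>k + 1\<close> into the
  binomial coefficient.\<close>

lemma sum_binomial_fact_pochhammer:
  fixes a :: real
  shows "a * (\<Sum>k\<le>n. real (n choose k) * (fact k * pochhammer a (n - k))) = pochhammer a (Suc n)"
proof (induction n)
  case (Suc n)
  have "a * (\<Sum>k\<le>Suc n. real (Suc n choose k) * (fact k * pochhammer a (Suc n - k)))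
    = a * pochhammer a (Suc n) + a * (\<Sum>k\<le>n. real (Suc n choose Suc k) * (fact (Suc k) * pochhammer a (n - k)))"
    by (subst sum.atMost_Suc_shift) (simp add: algebra_simps)
  also have "(\<Sum>k\<le>n. real (Suc n choose Suc k) * (fact (Suc k) * pochhammer a (n - k)))
    = real (Suc n) * (\<Sum>k\<le>n. real (n choose k) * (fact k * pochhammer a (n - k)))"
    unfolding sum_distrib_left
  proof (intro sum.cong refl)
    fix k
    have "real (Suc k) * real (Suc n choose Suc k) = real (Suc n) * real (n choose k)"
      using Suc_times_binomial_eq[of n k] by (metis mult.commute of_nat_mult)
    then show "real (Suc n choose Suc k) * (fact (Suc k) * pochhammer a (n - k))
      = real (Suc n) * (real (n choose k) * (fact k * pochhammer a (n - k)))"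
      by (simp add: fact_Suc mult_ac)
  qed
  also have "a * pochhammer a (Suc n) + a * (real (Suc n) * (\<Sum>k\<le>n. real (n choose k) * (fact k * pochhammer a (n - k))))
    = a * pochhammer a (Suc n) + real (Suc n) * pochhammer a (Suc n)"
    unfolding Suc.IH[symmetric] by (simp add: algebra_simps)
  also have "\<dots> = pochhammer a (Suc (Suc n))"
    by (simp add: pochhammer_Suc[of a "Suc n"] algebra_simps)
  finally show ?case .
qed simp

definition label_weight :: "'l set \<Rightarrow> ('l \<Rightarrow> real) \<Rightarrow> 'l \<Rightarrow> nat \<Rightarrow> real" where
  "label_weight D \<alpha> l n = (if l \<in> D then (if n = 0 then 1 else \<alpha> l * fact (n - 1)) else pochhammer (\<alpha> l) n)"

lemma label_weight_0 [simp]: "label_weight D \<alpha> l 0 = 1"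
  by (simp add: label_weight_def)

text \<open>The share of one label in the recursion, with \<open>A\<close> the indices carrying it
  and \<open>n\<close> their number. A dedicated block moves to atom \<open>0\<close> as a whole,
  and n! = n * (n-1)!. For a set label the sum over all \<open>S\<close>, minus the empty one, is
  (\<alpha>)_(n+1) - \<alpha> (\<alpha>)_(n) = n (\<alpha>)_(n).\<close>

lemma label_weight_recursion:
  assumes "finite A"
  shows "(\<Sum>S\<in>{S\<in>Pow A. S \<noteq> {} \<and> (l \<in> D \<longrightarrow> S = A)}. \<alpha> l * (fact (card S) * label_weight D \<alpha> l (card A - card S)))
    = real (card A) * label_weight D \<alpha> l (card A)"
proof (cases "l \<in> D")
  case True
  show ?thesis
  proof (cases "A = {}")
    case True
    then have "{S \<in> Pow A. S \<noteq> {} \<and> (l \<in> D \<longrightarrow> S = A)} = {}" by auto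
    then show ?thesis using True by simp
  next
    case False
    then have "{S \<in> Pow A. S \<noteq> {} \<and> (l \<in> D \<longrightarrow> S = A)} = {A}"
      using \<open>l \<in> D\<close> by auto
    moreover obtain n where "card A = Suc n"
      using False assms by (metis card_0_eq not0_implies_Suc)
    ultimately show ?thesis using \<open>l \<in> D\<close> by (simp add: label_weight_def mult_ac)
  qed
next
  case False
  let ?f = "\<lambda>S. \<alpha> l * (fact (card S) * pochhammer (\<alpha> l) (card A - card S))"
  have "{S \<in> Pow A. S \<noteq> {} \<and> (l \<in> D \<longrightarrow> S = A)} = Pow A - {{}}"
    using False by auto
  then have "(\<Sum>S\<in>{S\<in>Pow A. S \<noteq> {} \<and> (l \<in> D \<longrightarrow> S = A)}. ?f S) = (\<Sum>S\<in>Pow A. ?f S) - \<alpha> l * pochhammer (\<alpha> l) (card A)"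
    using assms by (simp add: sum_diff1)
  also have "(\<Sum>S\<in>Pow A. ?f S) = pochhammer (\<alpha> l) (Suc (card A))"
    unfolding sum_distrib_left[symmetric]
    by (subst sum_Pow_card[OF assms, where f = "\<lambda>k. fact k * pochhammer (\<alpha> l) (card A - k)"])
       (simp add: sum_binomial_fact_pochhammer)
  finally show ?thesis using False by (simp add: label_weight_def pochhammer_Suc algebra_simps)
qed

lemma sum_card_labels:
  fixes \<sigma> :: "'i \<Rightarrow> 'l :: finite"
  assumes "finite I"
  shows "(\<Sum>l\<in>UNIV. card {i\<in>I. \<sigma> i = l}) = card I"
  unfolding card_eq_sum by (rule sum.group) (use assms in auto)

text \<open>A nonempty \<open>S\<close> contributes only if its samples share one label: a dedicated
  label admits no other label on its atom, and two different set labels have disjoint hash sets.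
  Each label returns the claimed product times its count, and the counts add up to \<open>n\<close>.
  Disjointness is demanded of set labels only, since dedicated ones are told apart by their
  atoms.\<close>

lemma label_sum_eq:
  fixes \<sigma> :: "nat \<Rightarrow> 'l :: finite" and H :: "'h pmf"
  assumes \<theta>: "0 < \<theta>" and I: "finite I"
    and disj: "\<And>l l'. l \<notin> D \<Longrightarrow> l' \<notin> D \<Longrightarrow> l \<noteq> l' \<Longrightarrow> T l \<inter> T l' = {}"
  defines "\<alpha> \<equiv> \<lambda>l. \<theta> * measure_pmf.prob H (T l)"
  shows "label_sum \<theta> H D T \<sigma> I
    = ennreal ((\<Prod>l\<in>UNIV. label_weight D \<alpha> l (card {i\<in>I. \<sigma> i = l})) / pochhammer \<theta> (card I))"
  using I
proof (induction rule: finite_psubset_induct)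
  case (psubset I)
  let ?lw = "label_weight D \<alpha>" and ?N = "\<lambda>I l. card {i\<in>I. \<sigma> i = l}"
  let ?W = "\<lambda>I. \<Prod>l\<in>UNIV. ?lw l (?N I l)"
  have \<alpha>: "0 \<le> \<alpha> l" for l using \<theta> by (simp add: \<alpha>_def)
  have lw: "0 \<le> ?lw l k" for l k
    using \<alpha>[of l] by (auto simp: label_weight_def pochhammer_prod intro!: prod_nonneg)
  have poch: "0 < pochhammer \<theta> k" for k using \<theta> by (rule pochhammer_pos)
  show ?case
  proof (cases "I = {}")
    case True
    interpret V: prob_space "sticks \<theta>" by (rule prob_space_sticks[OF \<theta>])
    interpret Hs: prob_space "hashes H" by (intro prob_space_PiM measure_pmf.prob_space_axioms)
    show ?thesis
      using True Hs.emeasure_space_1 V.emeasure_space_1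
      by (simp add: label_sum_def label_compat_def atom_prob_def hash_prob_def nn_integral_count_space_finite)
  next
    case False
    define n where "n = card I"
    have n: "0 < n" using False psubset.hyps by (simp add: n_def card_gt_0_iff)
    let ?X = "label_sum \<theta> H D T \<sigma> I"
    \<comment> \<open>Finiteness of the unknown: dropping the compatibility indicator and the hash
      factor leaves the total mass of the assignments.\<close>
    have "?X \<le> (\<integral>\<^sup>+\<kappa>. atom_prob \<theta> I \<kappa> \<partial>count_space (I \<rightarrow>\<^sub>E UNIV))"
      unfolding label_sum_def
    proof (intro nn_integral_mono)
      fix \<kappa>
      interpret Hs: prob_space "hashes H" by (intro prob_space_PiM measure_pmf.prob_space_axioms)
      have "hash_prob H I (\<lambda>i. T (\<sigma> i)) \<kappa> \<le> 1"
        unfolding hash_prob_def by (rule Hs.emeasure_le_1)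
      then have "atom_prob \<theta> I \<kappa> * hash_prob H I (\<lambda>i. T (\<sigma> i)) \<kappa> \<le> atom_prob \<theta> I \<kappa> * 1"
        by (intro mult_left_mono) auto
      then show "indicator {\<kappa>. label_compat D \<sigma> I \<kappa>} \<kappa> * (atom_prob \<theta> I \<kappa> * hash_prob H I (\<lambda>i. T (\<sigma> i)) \<kappa>) \<le> atom_prob \<theta> I \<kappa>"
        by (simp split: split_indicator)
    qed
    also have "\<dots> \<le> 1" by (rule sum_atom_prob_le_1[OF \<theta> psubset.hyps])
    finally obtain x where x: "?X = ennreal x" "0 \<le> x"
      by (cases ?X) (auto simp: top_unique)
    \<comment> \<open>The real value of the summand for nonempty \<open>S\<close>: the induction
      hypothesis cancels the rising factorial of order \<open>card (I - S)\<close>.\<close>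
    define t where "t S = of_bool (zero_ok D \<sigma> I S) * (\<theta> * fact (card S) / pochhammer \<theta> (n + 1) *
       measure_pmf.prob H (\<Inter>i\<in>S. T (\<sigma> i))) * ?W (I - S)" for S
    have t_nonneg: "0 \<le> t S" for S
      unfolding t_def using \<theta> poch[of "n+1"] lw by (auto intro!: mult_nonneg_nonneg prod_nonneg divide_nonneg_pos)
    have t: "of_bool (zero_ok D \<sigma> I S) *
      (ennreal (\<theta> * fact (card S) * pochhammer \<theta> (card (I - S)) / pochhammer \<theta> (card I + 1)) *
       emeasure (measure_pmf H) (\<Inter>i\<in>S. T (\<sigma> i))) * label_sum \<theta> H D T \<sigma> (I - S) = ennreal (t S)"
      if S: "S \<in> Pow I - {{}}" for S
    proof -
      have IH: "label_sum \<theta> H D T \<sigma> (I - S) = ennreal (?W (I - S) / pochhammer \<theta> (card (I - S)))"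
        using S by (intro psubset.IH) auto
      have nn: "0 \<le> ?W (I - S)" using lw by (intro prod_nonneg) auto
      show ?thesis
        unfolding IH measure_pmf.emeasure_eq_measure t_def n_def using \<theta> poch nn
        by (simp add: ennreal_mult'[symmetric] less_imp_le[OF poch] less_imp_neq[OF poch, THEN not_sym])
    qed
    let ?F = "\<lambda>S. of_bool (zero_ok D \<sigma> I S) *
      (ennreal (\<theta> * fact (card S) * pochhammer \<theta> (card (I - S)) / pochhammer \<theta> (card I + 1)) *
       emeasure (measure_pmf H) (\<Inter>i\<in>S. T (\<sigma> i))) * label_sum \<theta> H D T \<sigma> (I - S)"
    have "?X = (\<Sum>S\<in>Pow I. ?F S)"
      by (rule label_sum_split[OF \<theta> psubset.hyps])
    also have "\<dots> = ?F {} + (\<Sum>S\<in>Pow I - {{}}. ?F S)"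
      by (rule sum.remove) (use psubset.hyps in auto)
    also have "(\<Sum>S\<in>Pow I - {{}}. ?F S) = (\<Sum>S\<in>Pow I - {{}}. ennreal (t S))"
      by (intro sum.cong refl t)
    \<comment> \<open>For empty \<open>S\<close> the condition \<open>zero_ok\<close> is vacuous and
      the hash factor is one, so the unknown itself reappears.\<close>
    also have "?F {} = ennreal (\<theta> * pochhammer \<theta> n / pochhammer \<theta> (n + 1)) * ?X"
      using measure_pmf.emeasure_space_1[of H] by (simp add: zero_ok_def n_def)
    also have "\<theta> * pochhammer \<theta> n / pochhammer \<theta> (n + 1) = \<theta> / (\<theta> + n)"
      using poch[of n] by (simp add: pochhammer_Suc)
    finally have "ennreal x = ennreal (\<theta> / (\<theta> + n) * x + (\<Sum>S\<in>Pow I - {{}}. t S))"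
      using x \<theta> t_nonneg by (simp add: ennreal_mult'[symmetric] sum_nonneg)
    then have rec: "x = \<theta> / (\<theta> + n) * x + (\<Sum>S\<in>Pow I - {{}}. t S)"
      using x(2) \<theta> t_nonneg by (subst (asm) ennreal_inj) (auto intro!: add_nonneg_nonneg sum_nonneg)
    \<comment> \<open>The admissible sets for atom \<open>0\<close> all of whose members carry label
      \<open>l\<close>; for a dedicated label only its full class remains.\<close>
    define P where "P l = {S \<in> Pow {i\<in>I. \<sigma> i = l}. S \<noteq> {} \<and> (l \<in> D \<longrightarrow> S = {i\<in>I. \<sigma> i = l})}" for l
    have fin: "finite (P l)" for l
      unfolding P_def using psubset.hyps by simp
    have tP: "t S = (\<Prod>l'\<in>UNIV - {l}. ?lw l' (?N I l')) / pochhammer \<theta> (n + 1) *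
      (\<alpha> l * (fact (card S) * ?lw l (?N I l - card S)))" if S: "S \<in> P l" for S l
    proof -
      have S': "S \<subseteq> I" "\<And>i. i \<in> S \<Longrightarrow> \<sigma> i = l" "S \<noteq> {}" using S by (auto simp: P_def)
      have ok: "zero_ok D \<sigma> I S"
      proof (cases "l \<in> D")
        case True
        then have "S = {i\<in>I. \<sigma> i = l}" using S by (simp add: P_def)
        then show ?thesis by (simp add: zero_ok_def eq_commute)
      next
        case False
        have "i' \<notin> S \<and> \<sigma> i \<noteq> \<sigma> i'" if "i \<in> S" "\<sigma> i \<in> D \<or> \<sigma> i' \<in> D" for i i'
          using S'(2) that False by metis
        then show ?thesis unfolding zero_ok_def by blast
      qed
      have "(\<Inter>i\<in>S. T (\<sigma> i)) = T l" using S' by auto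
      moreover have "?W (I - S) = ?lw l (?N I l - card S) * (\<Prod>l'\<in>UNIV - {l}. ?lw l' (?N I l'))"
      proof -
        have "{i \<in> I - S. \<sigma> i = l} = {i \<in> I. \<sigma> i = l} - S" by auto
        then have "?N (I - S) l = ?N I l - card S"
          using S' psubset.hyps by (simp add: card_Diff_subset finite_subset subset_iff)
        moreover have "(\<Prod>l'\<in>UNIV - {l}. ?lw l' (?N (I - S) l')) = (\<Prod>l'\<in>UNIV - {l}. ?lw l' (?N I l'))"
        proof (intro prod.cong refl)
          fix l' assume "l' \<in> UNIV - {l}"
          then have "{i \<in> I - S. \<sigma> i = l'} = {i \<in> I. \<sigma> i = l'}" using S' by auto
          then show "?lw l' (?N (I - S) l') = ?lw l' (?N I l')" by (simp only:)
        qed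
        ultimately show ?thesis
          using prod.remove[of UNIV l "\<lambda>l'. ?lw l' (?N (I - S) l')"] by (simp only: finite_code UNIV_I)
      qed
      ultimately show ?thesis using ok by (simp add: t_def \<alpha>_def)
    qed
    have "(\<Sum>S\<in>Pow I - {{}}. t S) = (\<Sum>S\<in>(\<Union>l\<in>UNIV. P l). t S)"
    proof (rule sum.mono_neutral_right)
      show "\<forall>S\<in>Pow I - {{}} - (\<Union>l. P l). t S = 0"
      proof
        fix S assume S: "S \<in> Pow I - {{}} - (\<Union>l. P l)"
        then obtain i where i: "i \<in> S" "i \<in> I" by auto
        have "\<not> zero_ok D \<sigma> I S \<or> (\<Inter>i\<in>S. T (\<sigma> i)) = {}"
        proof (rule ccontr)
          assume "\<not> ?thesis"
          then have ok: "zero_ok D \<sigma> I S" and ne: "(\<Inter>i\<in>S. T (\<sigma> i)) \<noteq> {}" by auto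
          have same: "\<sigma> i' = \<sigma> i" if "i' \<in> S" for i'
          proof (cases "\<sigma> i \<in> D \<or> \<sigma> i' \<in> D")
            case True
            moreover have "i' \<in> I" using that S by auto
            ultimately have "i' \<in> S \<longleftrightarrow> \<sigma> i = \<sigma> i'"
              using ok i(1) unfolding zero_ok_def by blast
            then show ?thesis using that by simp
          next
            case False
            obtain h where h: "h \<in> (\<Inter>i\<in>S. T (\<sigma> i))" using ne by blast
            have "h \<in> T (\<sigma> i)" "h \<in> T (\<sigma> i')"
              using INT_D[OF h i(1)] INT_D[OF h that] by simp_all
            then have "T (\<sigma> i) \<inter> T (\<sigma> i') \<noteq> {}" by blast
            then show ?thesis using disj[of "\<sigma> i" "\<sigma> i'"] False by metis
          qed
          have "S = {i'\<in>I. \<sigma> i' = \<sigma> i}" if "\<sigma> i \<in> D"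
          proof -
            have "i' \<in> S \<longleftrightarrow> \<sigma> i = \<sigma> i'" if "i' \<in> I" for i'
              using ok i(1) that \<open>\<sigma> i \<in> D\<close> unfolding zero_ok_def by blast
            then show ?thesis using S by (auto simp: eq_commute)
          qed
          moreover have "S \<subseteq> {i'\<in>I. \<sigma> i' = \<sigma> i}" using same S by blast
          ultimately have "S \<in> P (\<sigma> i)" using i(1) unfolding P_def by blast
          with S show False by blast
        qed
        then show "t S = 0" by (auto simp: t_def)
      qed
    qed (use psubset.hyps in \<open>auto simp: P_def\<close>)
    also have "\<dots> = (\<Sum>l\<in>UNIV. \<Sum>S\<in>P l. t S)"
      by (rule sum.UNION_disjoint) (simp_all add: fin, auto simp: P_def)
    also have "\<dots> = (\<Sum>l\<in>UNIV. real (?N I l) * (?W I / pochhammer \<theta> (n + 1)))"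
    proof (intro sum.cong refl)
      fix l
      have "(\<Sum>S\<in>P l. t S) = (\<Prod>l'\<in>UNIV - {l}. ?lw l' (?N I l')) / pochhammer \<theta> (n + 1) *
        (\<Sum>S\<in>P l. \<alpha> l * (fact (card S) * ?lw l (?N I l - card S)))"
        unfolding sum_distrib_left by (intro sum.cong refl) (simp add: tP)
      also have "(\<Sum>S\<in>P l. \<alpha> l * (fact (card S) * ?lw l (?N I l - card S))) = real (?N I l) * ?lw l (?N I l)"
        unfolding P_def by (rule label_weight_recursion) (use psubset.hyps in simp)
      finally show "(\<Sum>S\<in>P l. t S) = real (?N I l) * (?W I / pochhammer \<theta> (n + 1))"
        by (simp add: prod.remove[of UNIV l] mult_ac)
    qed
    also have "\<dots> = real n * (?W I / pochhammer \<theta> (n + 1))"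
    proof -
      have "(\<Sum>l\<in>UNIV. ?N I l) = n"
        unfolding n_def using psubset.hyps by (rule sum_card_labels)
      then show ?thesis unfolding sum_distrib_right[symmetric] by (simp add: of_nat_sum[symmetric] del: of_nat_sum)
    qed
    finally have sum: "(\<Sum>S\<in>Pow I - {{}}. t S) = real n * (?W I / pochhammer \<theta> (n + 1))" .
    \<comment> \<open>Moving the returning term to the left leaves the factor n/(\<theta> + n). The
      same factor splits off on the right from the rising factorial of order n + 1, and it is
      nonzero because \<open>n\<close> is positive.\<close>
    have "x * (real n / (\<theta> + n)) = x - \<theta> / (\<theta> + n) * x"
      using \<theta> by (simp add: field_simps)
    also have "\<dots> = real n * (?W I / pochhammer \<theta> (n + 1))"
      using rec sum by linarith
    also have "\<dots> = ?W I / pochhammer \<theta> n * (real n / (\<theta> + n))"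
      by (simp add: pochhammer_Suc mult_ac)
    finally have "x = ?W I / pochhammer \<theta> n"
      using \<theta> n by (simp only: mult_cancel_right divide_eq_0_iff of_nat_eq_0_iff) linarith
    then show ?thesis using x by (simp add: n_def)
  qed
qed

section \<open>Reduction of the model to atom indices and hash values\<close>

text \<open>A singleton has only itself and the empty set as subsets, so no subset can have measure
  strictly in between.\<close>

lemma nonatomic_singleton_null:
  assumes "nonatomic \<nu>" "{x} \<in> sets \<nu>"
  shows "emeasure \<nu> {x} = 0"
proof (rule ccontr)
  assume "emeasure \<nu> {x} \<noteq> 0"
  then obtain B where "B \<subseteq> {x}" "0 < emeasure \<nu> B" "emeasure \<nu> B < emeasure \<nu> {x}"
    using assms by (auto simp: nonatomic_def zero_less_iff_neq_zero)
  then show False by (cases "B = {}") (auto dest: subset_singletonD)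
qed

locale dp_hash =
  fixes \<nu> :: "'v measure" and \<theta> :: real and J :: nat
  assumes prob_\<nu>: "prob_space \<nu>"
    and diagonal: "{p \<in> space (\<nu> \<Otimes>\<^sub>M \<nu>). fst p = snd p} \<in> sets (\<nu> \<Otimes>\<^sub>M \<nu>)"
    and nonatomic: "nonatomic \<nu>"
    and \<theta>: "\<theta> > 0"
begin

abbreviation "locs \<equiv> \<Pi>\<^sub>M j\<in>(UNIV::nat set). \<nu>"
abbreviation "hpmf \<equiv> pmf_of_set {1..J}"
abbreviation "M \<equiv> dp_model \<nu> \<theta> J"

text \<open>A coincidence of two \<open>\<nu>\<close>-valued maps is the preimage of the diagonal.
  Measurability of ties between samples, and hence of \<open>freq\<close>, rests on this.\<close>

lemma measurable_eq:
  assumes [measurable]: "f \<in> measurable N \<nu>" "g \<in> measurable N \<nu>"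
  shows "Measurable.pred N (\<lambda>x. f x = g x)"
proof -
  have "(\<lambda>x. (f x, g x)) -` {p \<in> space (\<nu> \<Otimes>\<^sub>M \<nu>). fst p = snd p} \<inter> space N \<in> sets N"
    by (rule measurable_sets[OF _ diagonal]) measurable
  also have "(\<lambda>x. (f x, g x)) -` {p \<in> space (\<nu> \<Otimes>\<^sub>M \<nu>). fst p = snd p} \<inter> space N = {x \<in> space N. f x = g x}"
    using measurable_space[OF assms(1)] measurable_space[OF assms(2)] by (auto simp: space_pair_measure)
  finally show ?thesis by (simp add: pred_def)
qed

text \<open>The section of the measurable diagonal at \<open>x\<close> is \<open>{x}\<close>, so
  singletons are events to which nonatomicity applies.\<close>

lemma singleton_null: "x \<in> space \<nu> \<Longrightarrow> {x} \<in> sets \<nu>" "x \<in> space \<nu> \<Longrightarrow> emeasure \<nu> {x} = 0"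
proof -
  assume x: "x \<in> space \<nu>"
  have "Pair x -` {p \<in> space (\<nu> \<Otimes>\<^sub>M \<nu>). fst p = snd p} \<in> sets \<nu>"
    by (rule sets_Pair1[OF diagonal])
  also have "Pair x -` {p \<in> space (\<nu> \<Otimes>\<^sub>M \<nu>). fst p = snd p} = {x}"
    using x by (auto simp: space_pair_measure)
  finally show "{x} \<in> sets \<nu>" .
  then show "emeasure \<nu> {x} = 0" by (rule nonatomic_singleton_null[OF nonatomic])
qed

text \<open>Removing the first location lowers both indices, down to the comparison of the first
  location with a later, independent one, which hits a given point with probability zero. The offset
  \<open>Suc d\<close> keeps the indices distinct.\<close>

lemma emeasure_locs_eq: "emeasure locs {y \<in> space locs. y i = y (i + Suc d)} = 0"
proof (induction i)
  interpret N: prob_space \<nu> by (rule prob_\<nu>)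
  interpret P: sequence_space \<nu> by standard
  note [measurable (raw)] = measurable_eq
  note split = nn_integral_PiM_nat_split[OF prob_\<nu>]
  have ind: "indicator {y \<in> space locs. y i = y j} y = (of_bool (y i = y j) :: ennreal)" if "y \<in> space locs" for i j y
    using that by (simp add: indicator_def)
  have emeas: "emeasure locs {y \<in> space locs. y i = y j} = (\<integral>\<^sup>+y. of_bool (y i = y j) \<partial>locs)" for i j
  proof -
    have "emeasure locs {y \<in> space locs. y i = y j} = (\<integral>\<^sup>+y. indicator {y \<in> space locs. y i = y j} y \<partial>locs)"
      by (rule nn_integral_indicator[symmetric]) measurable
    also have "\<dots> = (\<integral>\<^sup>+y. of_bool (y i = y j) \<partial>locs)" by (intro nn_integral_cong ind)
    finally show ?thesis .
  qed
  {
    case 0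
    have "(\<integral>\<^sup>+y. of_bool (y 0 = y (Suc d)) \<partial>locs) = (\<integral>\<^sup>+x. \<integral>\<^sup>+y. of_bool (x = y d) \<partial>locs \<partial>\<nu>)"
      by (subst split) auto
    also have "\<dots> = (\<integral>\<^sup>+x. 0 \<partial>\<nu>)"
    proof (intro nn_integral_cong)
      fix x assume x: "x \<in> space \<nu>"
      have "(\<integral>\<^sup>+y. of_bool (x = y d) \<partial>locs) = (\<integral>\<^sup>+y. indicator {x} (y d) \<partial>locs)"
        by (intro nn_integral_cong) (auto simp: indicator_def)
      also have "\<dots> = (\<integral>\<^sup>+z. indicator {x} z \<partial>distr locs \<nu> (\<lambda>y. y d))"
        using singleton_null(1)[OF x] by (subst nn_integral_distr) auto
      also have "\<dots> = emeasure \<nu> {x}"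
        using singleton_null(1)[OF x] by (subst P.PiM_component) auto
      finally show "(\<integral>\<^sup>+y. of_bool (x = y d) \<partial>locs) = 0" by (simp add: singleton_null[OF x])
    qed
    finally show ?case unfolding emeas by simp
  next
    case (Suc i)
    have "(\<integral>\<^sup>+y. of_bool (y (Suc i) = y (Suc i + Suc d)) \<partial>locs) = (\<integral>\<^sup>+x. \<integral>\<^sup>+y. of_bool (y i = y (i + Suc d)) \<partial>locs \<partial>\<nu>)"
      by (subst split) auto
    also have "\<dots> = 0" using Suc by (simp add: emeas)
    finally show ?case unfolding emeas .
  }
qed

lemma AE_locs_inj: "AE y in locs. inj y"
proof -
  note [measurable (raw)] = measurable_eq
  have "AE y in locs. y i \<noteq> y (i + Suc d)" for i d
    using emeasure_locs_eq[of i d] by (intro AE_I) auto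
  then have "AE y in locs. \<forall>i d. y i \<noteq> y (i + Suc d)"
    by (simp add: AE_all_countable)
  then show ?thesis
  proof eventually_elim
    case (elim y)
    show "inj y"
    proof (rule linorder_injI)
      fix i j :: nat assume "i < j"
      then show "y i \<noteq> y j" using elim[rule_format, of i "j - i - 1"] by simp
    qed
  qed
qed

section \<open>Measurability of samples, frequencies and buckets\<close>

lemma prob_space_parts: "prob_space locs" "prob_space unifs" "prob_space (hashes H)" "prob_space (sticks \<theta>)"
  by (auto intro!: prob_space_PiM prob_space_unif01 measure_pmf.prob_space_axioms prob_\<nu> prob_space_beta_measure_1 \<theta>)

lemma prob_space_M: "prob_space M"
  unfolding dp_model_def by (intro prob_space_pair prob_space_parts)

lemma atom_index_alt: "atom_index \<omega> i = stick_index (fst \<omega>) (fst (snd (snd \<omega>)) i)"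
  by (simp add: atom_index_def stick_index_def split_beta)

lemma measurable_components [measurable]:
  "fst \<in> measurable M (sticks \<theta>)"
  "(\<lambda>\<omega>. fst (snd \<omega>)) \<in> measurable M locs"
  "(\<lambda>\<omega>. fst (snd (snd \<omega>))) \<in> measurable M unifs"
  "(\<lambda>\<omega>. snd (snd (snd \<omega>))) \<in> measurable M (hashes hpmf)"
  unfolding dp_model_def by measurable

lemma measurable_coordinates [measurable]:
  "(\<lambda>\<omega>. fst (snd \<omega>) j) \<in> measurable M \<nu>"
  "(\<lambda>\<omega>. fst (snd (snd \<omega>)) j) \<in> borel_measurable M"
  "(\<lambda>\<omega>. snd (snd (snd \<omega>)) j) \<in> measurable M (count_space UNIV)"
proof -
  show "(\<lambda>\<omega>. fst (snd \<omega>) j) \<in> measurable M \<nu>"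
    by (rule measurable_compose[OF measurable_components(2)]) simp
  have "(\<lambda>\<omega>. fst (snd (snd \<omega>)) j) \<in> measurable M unif01"
    by (rule measurable_compose[OF measurable_components(3)]) (rule measurable_component_singleton, simp)
  then show "(\<lambda>\<omega>. fst (snd (snd \<omega>)) j) \<in> borel_measurable M"
    by (simp cong: measurable_cong_sets)
  have "(\<lambda>\<omega>. snd (snd (snd \<omega>)) j) \<in> measurable M (measure_pmf hpmf)"
    by (rule measurable_compose[OF measurable_components(4)]) (rule measurable_component_singleton, simp)
  then show "(\<lambda>\<omega>. snd (snd (snd \<omega>)) j) \<in> measurable M (count_space UNIV)"
    by (simp cong: measurable_cong_sets)
qed

lemma measurable_atom_index [measurable]: "(\<lambda>\<omega>. atom_index \<omega> i) \<in> measurable M (count_space UNIV)"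
  unfolding atom_index_alt by (rule measurable_stick_index[OF measurable_components(1) measurable_coordinates(2)])

lemma measurable_Xobs [measurable]: "(\<lambda>\<omega>. Xobs \<omega> i) \<in> measurable M \<nu>"
  using measurable_compose_countable[OF measurable_coordinates(1) measurable_atom_index]
  by (simp add: Xobs_def split_beta)

lemma measurable_hash [measurable]: "(\<lambda>\<omega>. hash \<omega> (Xobs \<omega> i)) \<in> measurable M (count_space UNIV)"
proof -
  have "(\<lambda>\<omega>. LEAST j. fst (snd \<omega>) j = Xobs \<omega> i) \<in> measurable M (count_space UNIV)"
    by (intro measurable_Least measurable_eq measurable_Xobs measurable_coordinates)
  from measurable_compose_countable[OF measurable_coordinates(3) this]
  show ?thesis by (simp add: hash_def split_beta)
qed

lemma measurable_freq: "(\<lambda>\<omega>. freq m \<omega> r) \<in> measurable M (count_space UNIV)"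
  unfolding freq_def
proof (rule measurable_card)
  fix i
  have "{\<omega> \<in> space M. Xobs \<omega> i = Xobs \<omega> (m + r)} \<in> sets M"
    using measurable_eq[OF measurable_Xobs measurable_Xobs] by (simp add: pred_def)
  then show "{\<omega> \<in> space M. i \<in> {i \<in> {1..m}. Xobs \<omega> i = Xobs \<omega> (m + r)}} \<in> sets M"
    by (cases "i \<in> {1..m}") simp_all
qed

lemma measurable_bucket: "(\<lambda>\<omega>. bucket m \<omega> r) \<in> measurable M (count_space UNIV)"
  unfolding bucket_def
proof (rule measurable_card)
  fix i
  let ?f = "\<lambda>i \<omega>. hash \<omega> (Xobs \<omega> i)"
  have "(\<Union>n. (?f i -` {n} \<inter> space M) \<inter> (?f (m + r) -` {n} \<inter> space M)) \<in> sets M"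
    by (intro sets.countable_UN' sets.Int measurable_sets[OF measurable_hash]) auto
  also have "(\<Union>n. (?f i -` {n} \<inter> space M) \<inter> (?f (m + r) -` {n} \<inter> space M)) = {\<omega> \<in> space M. ?f i \<omega> = ?f (m + r) \<omega>}"
    by auto
  finally have "{\<omega> \<in> space M. hash \<omega> (Xobs \<omega> i) = hash \<omega> (Xobs \<omega> (m + r))} \<in> sets M" .
  then show "{\<omega> \<in> space M. i \<in> {i \<in> {1..m}. hash \<omega> (Xobs \<omega> i) = hash \<omega> (Xobs \<omega> (m + r))}} \<in> sets M"
    by (cases "i \<in> {1..m}") simp_all
qed

lemma AE_inj_locations: "AE \<omega> in M. inj (fst (snd \<omega>))"
proof -
  interpret L: prob_space locs by (rule prob_space_parts)
  interpret UH: pair_prob_space unifs "hashes hpmf" by (intro pair_prob_space.intro pair_sigma_finite.intro prob_space_imp_sigma_finite prob_space_parts)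
  interpret LUH: pair_prob_space locs "unifs \<Otimes>\<^sub>M hashes hpmf" ..
  interpret V: prob_space "sticks \<theta>" by (rule prob_space_parts)
  interpret VLUH: pair_prob_space "sticks \<theta>" "locs \<Otimes>\<^sub>M (unifs \<Otimes>\<^sub>M hashes hpmf)" ..
  have "{y \<in> space locs. inj y} \<in> sets locs"
    using measurable_eq[measurable (raw)] unfolding inj_def by measurable
  then have meas: "Measurable.pred (locs \<Otimes>\<^sub>M (unifs \<Otimes>\<^sub>M hashes hpmf)) (\<lambda>z. inj (fst z))"
    by (intro measurable_compose[OF measurable_fst]) (simp add: pred_def)
  have "AE z in locs \<Otimes>\<^sub>M (unifs \<Otimes>\<^sub>M hashes hpmf). inj (fst z)"
    using AE_locs_inj meas by (intro LUH.AE_pair_measure) (auto simp: pred_def)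
  then show ?thesis
    unfolding dp_model_def using measurable_compose[OF measurable_snd meas]
    by (intro VLUH.AE_pair_measure) (auto simp: pred_def)
qed

lemma Xobs_eq_iff:
  assumes "inj (fst (snd \<omega>))"
  shows "Xobs \<omega> i = Xobs \<omega> k \<longleftrightarrow> atom_index \<omega> i = atom_index \<omega> k"
  using assms by (simp add: Xobs_def split_beta inj_eq)

text \<open>With distinct locations the atom index is the only \<open>j\<close> at which the sample
  can be found, so \<open>LEAST\<close> in \<open>hash\<close> recovers it.\<close>

lemma hash_Xobs:
  assumes "inj (fst (snd \<omega>))"
  shows "hash \<omega> (Xobs \<omega> i) = snd (snd (snd \<omega>)) (atom_index \<omega> i)"
  using assms by (simp add: hash_def Xobs_def split_beta inj_eq Least_equality)

text \<open>For fixed sticks the event is a rectangle: the locations are free, the uniforms choose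
  the atoms, the hash values lie in \<open>A\<close>. The product measure then factors, and
  integration over the sticks produces \<open>atom_prob\<close>.\<close>

lemma emeasure_atoms_hashes:
  assumes I: "finite I" and A: "A \<in> sets (hashes hpmf)"
  shows "{\<omega> \<in> space M. (\<forall>i\<in>I. atom_index \<omega> i = \<kappa> i) \<and> snd (snd (snd \<omega>)) \<in> A} \<in> sets M" (is "?B \<in> _")
    and "emeasure M {\<omega> \<in> space M. (\<forall>i\<in>I. atom_index \<omega> i = \<kappa> i) \<and> snd (snd (snd \<omega>)) \<in> A}
      = atom_prob \<theta> I \<kappa> * emeasure (hashes hpmf) A"
proof -
  interpret L: prob_space locs by (rule prob_space_parts)
  interpret H: prob_space "hashes hpmf" by (rule prob_space_parts)
  interpret UH: pair_prob_space unifs "hashes hpmf" by (intro pair_prob_space.intro pair_sigma_finite.intro prob_space_imp_sigma_finite prob_space_parts)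
  interpret LUH: pair_prob_space locs "unifs \<Otimes>\<^sub>M hashes hpmf" ..
  show B [measurable]: "?B \<in> sets M"
    using I A by measurable
  have "emeasure M ?B = (\<integral>\<^sup>+v. emeasure (locs \<Otimes>\<^sub>M (unifs \<Otimes>\<^sub>M hashes hpmf)) (Pair v -` ?B) \<partial>sticks \<theta>)"
    using B unfolding dp_model_def by (rule LUH.emeasure_pair_measure_alt)
  also have "\<dots> = (\<integral>\<^sup>+v. (\<Prod>i\<in>I. ennreal (stick_weight v (\<kappa> i))) * emeasure (hashes hpmf) A \<partial>sticks \<theta>)"
    using AE_emeasure_stick_indices[OF \<theta> I] AE_space[of "sticks \<theta>"]
  proof (intro nn_integral_cong_AE, eventually_elim)
    case (elim v)
    let ?U = "{u \<in> space unifs. \<forall>i\<in>I. stick_index v (u i) = \<kappa> i}"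
    have U: "?U \<in> sets unifs"
      using I elim by measurable
    have "Pair v -` ?B = space locs \<times> (?U \<times> A)"
      using elim sets.sets_into_space[OF A]
      by (auto simp: atom_index_alt dp_model_def space_pair_measure)
    then have "emeasure (locs \<Otimes>\<^sub>M (unifs \<Otimes>\<^sub>M hashes hpmf)) (Pair v -` ?B)
        = emeasure locs (space locs) * emeasure (unifs \<Otimes>\<^sub>M hashes hpmf) (?U \<times> A)"
      using U A by (simp only:) (intro UH.emeasure_pair_measure_Times sets.top pair_measureI)
    also have "emeasure (unifs \<Otimes>\<^sub>M hashes hpmf) (?U \<times> A) = emeasure unifs ?U * emeasure (hashes hpmf) A"
      by (rule H.emeasure_pair_measure_Times[OF U A])
    finally show ?case
      using elim by (simp only: L.emeasure_space_1 mult_1_left)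
  qed
  also have "\<dots> = atom_prob \<theta> I \<kappa> * emeasure (hashes hpmf) A"
    unfolding atom_prob_def by (rule nn_integral_multc) simp
  finally show "emeasure M ?B = atom_prob \<theta> I \<kappa> * emeasure (hashes hpmf) A" .
qed

text \<open>The event splits into countably many disjoint pieces according to the atom indices on
  \<open>I\<close>, and the pieces are the summands of \<open>label_sum\<close>.\<close>

lemma emeasure_label_event:
  fixes \<sigma> :: "nat \<Rightarrow> 'l" and D :: "'l set" and T :: "'l \<Rightarrow> nat set"
  assumes I: "finite I"
  defines "E \<equiv> {\<omega> \<in> space M. label_compat D \<sigma> I (atom_index \<omega>) \<and> (\<forall>i\<in>I. snd (snd (snd \<omega>)) (atom_index \<omega> i) \<in> T (\<sigma> i))}"
  shows "E \<in> sets M" and "emeasure M E = label_sum \<theta> hpmf D T \<sigma> I"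
proof -
  \<comment> \<open>Compatibility involves no hash value; placed inside the hash event, it makes the
    pieces of incompatible assignments empty.\<close>
  let ?A = "\<lambda>\<kappa>. {h \<in> space (hashes hpmf). label_compat D \<sigma> I \<kappa> \<and> (\<forall>i\<in>I. h (\<kappa> i) \<in> T (\<sigma> i))}"
  let ?B = "\<lambda>\<kappa>. {\<omega> \<in> space M. (\<forall>i\<in>I. atom_index \<omega> i = \<kappa> i) \<and> snd (snd (snd \<omega>)) \<in> ?A \<kappa>}"
  have A: "?A \<kappa> \<in> sets (hashes hpmf)" for \<kappa>
    using I by measurable
  have "E = (\<Union>\<kappa>\<in>I \<rightarrow>\<^sub>E UNIV. ?B \<kappa>)"
  proof (intro set_eqI iffI)
    fix \<omega> assume "\<omega> \<in> E"
    then show "\<omega> \<in> (\<Union>\<kappa>\<in>I \<rightarrow>\<^sub>E UNIV. ?B \<kappa>)"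
      by (intro UN_I[of "restrict (atom_index \<omega>) I"]) (auto simp: E_def label_compat_def)
  qed (auto simp: E_def label_compat_def)
  moreover have "disjoint_family_on ?B (I \<rightarrow>\<^sub>E UNIV)"
    unfolding disjoint_family_on_def
  proof safe
    fix \<kappa> \<kappa>' :: "_ \<Rightarrow> nat" and \<omega>
    assume "\<kappa> \<in> I \<rightarrow>\<^sub>E UNIV" "\<kappa>' \<in> I \<rightarrow>\<^sub>E UNIV" "\<kappa> \<noteq> \<kappa>'"
      "\<forall>i\<in>I. atom_index \<omega> i = \<kappa> i" "\<forall>i\<in>I. atom_index \<omega> i = \<kappa>' i"
    then show "\<omega> \<in> {}" by (metis PiE_ext)
  qed
  moreover have "countable (I \<rightarrow>\<^sub>E (UNIV :: nat set))"
    using I by (intro countable_PiE) auto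
  ultimately show "E \<in> sets M"
    and "emeasure M E = label_sum \<theta> hpmf D T \<sigma> I"
    using emeasure_atoms_hashes[OF I A]
    by (auto intro!: sets.countable_UN'' nn_integral_cong simp: emeasure_UN_countable label_sum_def hash_prob_def split: split_indicator)
qed

end

section \<open>Counting labellings\<close>

text \<open>The convention that a factorial of a negative integer annihilates its term. It lets
  prescribed class sizes such as \<open>c1 - l1\<close> be integers, with no case split on their
  sign.\<close>

definition inv_fact :: "int \<Rightarrow> real" where
  "inv_fact k = (if k < 0 then 0 else 1 / fact (nat k))"

lemma inv_fact_pred: "inv_fact (k - 1) = real_of_int k * inv_fact k"
proof (cases "k \<le> 0")
  case False
  then obtain n where "k = int (Suc n)" by (metis not_le pos_int_cases Suc_pred)
  then show ?thesis by (simp add: inv_fact_def nat_add_distrib add.commute)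
qed (auto simp: inv_fact_def)

text \<open>The multinomial coefficient, with both sides zero when some prescribed size is negative.
  Deleting one point lowers the size of its class by one; by \<open>inv_fact_pred\<close> this
  multiplies the product by that size, and the sizes add up to the number of points.\<close>

lemma card_labelings:
  fixes k :: "'l :: finite \<Rightarrow> int"
  assumes "finite A" "(\<Sum>l\<in>UNIV. k l) = int (card A)"
  shows "real (card {f \<in> A \<rightarrow>\<^sub>E UNIV. \<forall>l. int (card {i\<in>A. f i = l}) = k l}) = fact (card A) * (\<Prod>l\<in>UNIV. inv_fact (k l))"
  using assms
proof (induction A arbitrary: k rule: finite_induct)
  case empty
  show ?case
  proof (cases "\<forall>l. k l = 0")
    case True
    then show ?thesis by (simp add: inv_fact_def)
  next
    case False
    have "\<exists>l. k l < 0"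
    proof (rule ccontr)
      assume "\<not> ?thesis"
      then have "\<And>l. 0 \<le> k l" by (simp add: not_less)
      then have "\<forall>l\<in>UNIV. k l = 0"
        using empty sum_nonneg_eq_0_iff[of UNIV k] by simp
      with False show False by simp
    qed
    then obtain l where l: "k l < 0" by blast
    then have "(\<Prod>l\<in>UNIV. inv_fact (k l)) = 0"
      by (intro prod_zero) (auto simp: inv_fact_def)
    moreover have "\<not> (\<forall>l. int (card {i\<in>{}. f i = l}) = k l)" for f :: "'a \<Rightarrow> 'l"
      using l by (auto intro!: exI[of _ l])
    ultimately show ?thesis by (simp only: simp_thms Collect_empty_eq) simp
  qed
next
  case (insert x A)
  let ?F = "\<lambda>A k. {f \<in> A \<rightarrow>\<^sub>E (UNIV :: 'l set). \<forall>l. int (card {i\<in>A. f i = l}) = k l}"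
  let ?k = "\<lambda>l0. k(l0 := k l0 - 1)"
  have count: "int (card {i\<in>insert x A. f i = l}) = int (card {i\<in>A. f i = l}) + of_bool (f x = l)" for f :: "_ \<Rightarrow> 'l" and l
  proof -
    have "{i\<in>insert x A. f i = l} = (if f x = l then insert x {i\<in>A. f i = l} else {i\<in>A. f i = l})" by auto
    then show ?thesis using insert.hyps by auto
  qed
  have bij: "bij_betw (\<lambda>(l0, f). f(x := l0)) (SIGMA l0:UNIV. ?F A (?k l0)) (?F (insert x A) k)"
  proof (rule bij_betwI[where g = "\<lambda>f. (f x, f(x := undefined))"], goal_cases)
    case 1
    have "f(x := l0) \<in> ?F (insert x A) k" if f: "f \<in> ?F A (?k l0)" for l0 f
    proof -
      have "{i\<in>A. (f(x := l0)) i = l} = {i\<in>A. f i = l}" for l using insert.hyps by auto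
      then show ?thesis
        using f unfolding mem_Collect_eq count by (auto simp: PiE_def extensional_def)
    qed
    then show ?case
      by (intro Pi_I) (simp only: split_paired_all mem_Sigma_iff split_conv)
  next
    case 2
    have "f(x := undefined) \<in> ?F A (?k (f x))" if f: "f \<in> ?F (insert x A) k" for f
    proof -
      have "{i\<in>A. (f(x := undefined)) i = l} = {i\<in>A. f i = l}" for l using insert.hyps by auto
      moreover have "int (card {i\<in>A. f i = l}) = k l - of_bool (f x = l)" for l
        using f count[of f l] by auto
      ultimately show ?thesis
        using f by (auto simp: PiE_def extensional_def)
    qed
    then show ?case
      by (intro Pi_I) (simp only: mem_Sigma_iff UNIV_I simp_thms)
  next
    case (3 z)
    then obtain l0 f where z: "z = (l0, f)" "f \<in> A \<rightarrow>\<^sub>E UNIV" by (cases z) simp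
    then have "f x = undefined" using insert.hyps by (auto simp: PiE_def extensional_def)
    then have "f(x := undefined) = f" by (metis fun_upd_triv)
    then show ?case by (simp add: z(1))
  next
    case (4 f)
    then show ?case by auto
  qed
  have fin: "finite (?F A k')" for k'
    using insert.hyps by (intro finite_subset[OF _ finite_PiE[of A "\<lambda>_. UNIV"]]) auto
  have card_eq: "card (?F (insert x A) k) = (\<Sum>l0\<in>UNIV. card (?F A (?k l0)))"
    using bij_betw_same_card[OF bij] fin by (simp add: card_SigmaI)
  have "real (card (?F (insert x A) k)) = (\<Sum>l0\<in>UNIV. fact (card A) * (\<Prod>l\<in>UNIV. inv_fact (?k l0 l)))"
  proof -
    have "(\<Sum>l\<in>UNIV. ?k l0 l) = int (card A)" for l0
    proof -
      have "(\<Sum>l\<in>UNIV. ?k l0 l) = (\<Sum>l\<in>UNIV. k l - of_bool (l = l0))" by (intro sum.cong) auto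
      also have "\<dots> = (\<Sum>l\<in>UNIV. k l) - 1" by (simp add: sum_subtractf of_bool_def)
      finally show ?thesis using insert by simp
    qed
    then show ?thesis
      unfolding card_eq of_nat_sum by (intro sum.cong refl insert.IH)
  qed
  also have "\<dots> = (\<Sum>l0\<in>UNIV. fact (card A) * (real_of_int (k l0) * (\<Prod>l\<in>UNIV. inv_fact (k l))))"
  proof (intro sum.cong refl arg_cong2[where f = "(*)"])
    fix l0
    have "(\<Prod>l\<in>UNIV. inv_fact (?k l0 l)) = inv_fact (k l0 - 1) * (\<Prod>l\<in>UNIV - {l0}. inv_fact (k l))"
      by (subst prod.remove[of _ l0]) auto
    also have "\<dots> = real_of_int (k l0) * (\<Prod>l\<in>UNIV. inv_fact (k l))"
      by (subst (2) prod.remove[of _ l0]) (auto simp: inv_fact_pred)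
    finally show "(\<Prod>l\<in>UNIV. inv_fact (?k l0 l)) = real_of_int (k l0) * (\<Prod>l\<in>UNIV. inv_fact (k l))" .
  qed
  also have "\<dots> = fact (card A) * (\<Prod>l\<in>UNIV. inv_fact (k l)) * real_of_int (\<Sum>l\<in>UNIV. k l)"
    unfolding sum_distrib_left[symmetric] sum_distrib_right[symmetric] of_int_sum by (simp add: mult_ac)
  also have "real_of_int (\<Sum>l\<in>UNIV. k l) = real (Suc (card A))"
    unfolding insert.prems using insert.hyps by simp
  finally show ?case using insert.hyps by (simp add: mult_ac)
qed

text \<open>The sizes \<open>k\<close> refer to the first \<open>m\<close> samples only, as
  \<open>freq\<close> and \<open>bucket\<close> do; the two new samples have fixed labels and are
  added to their classes afterwards.\<close>

definition labelings :: "nat \<Rightarrow> 'l \<Rightarrow> 'l \<Rightarrow> ('l \<Rightarrow> int) \<Rightarrow> (nat \<Rightarrow> 'l) set" where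
  "labelings m a1 a2 k = {\<sigma> \<in> {1..m+2} \<rightarrow>\<^sub>E UNIV. \<sigma> (m+1) = a1 \<and> \<sigma> (m+2) = a2 \<and>
     (\<forall>l. int (card {i\<in>{1..m}. \<sigma> i = l}) = k l)}"

lemma real_card_labelings:
  fixes k :: "'l :: finite \<Rightarrow> int"
  assumes "(\<Sum>l\<in>UNIV. k l) = int m"
  shows "real (card (labelings m a1 a2 k)) = fact m * (\<Prod>l\<in>UNIV. inv_fact (k l))"
proof -
  let ?F = "{f \<in> {1..m} \<rightarrow>\<^sub>E UNIV. \<forall>l. int (card {i\<in>{1..m}. f i = l}) = k l}"
  have eq: "{i\<in>{1..m}. f i = l} = {i\<in>{1..m}. g i = l}" if "\<And>i. i \<in> {1..m} \<Longrightarrow> f i = g i" for f g :: "nat \<Rightarrow> 'l" and l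
    using that by auto
  have "bij_betw (\<lambda>f. f(m+1 := a1, m+2 := a2)) ?F (labelings m a1 a2 k)"
  proof (rule bij_betwI[where g = "\<lambda>\<sigma>. restrict \<sigma> {1..m}"], goal_cases)
    case 1
    have "f(m+1 := a1, m+2 := a2) \<in> labelings m a1 a2 k" if f: "f \<in> ?F" for f
    proof -
      have "f(m+1 := a1, m+2 := a2) \<in> {1..m+2} \<rightarrow>\<^sub>E UNIV"
        using f by (auto simp: PiE_def extensional_def)
      then show ?thesis
        using f eq[of "f(m+1 := a1, m+2 := a2)" f] by (simp add: labelings_def)
    qed
    then show ?case by blast
  next
    case 2
    have "restrict \<sigma> {1..m} \<in> ?F" if "\<sigma> \<in> labelings m a1 a2 k" for \<sigma>
      using that eq[of "restrict \<sigma> {1..m}" \<sigma>] by (simp add: labelings_def)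
    then show ?case by blast
  next
    case (3 f)
    then show ?case by (auto simp: PiE_def extensional_def fun_eq_iff)
  next
    case (4 \<sigma>)
    have "i \<in> {1..m+2} \<longleftrightarrow> i \<in> {1..m} \<or> i = m+1 \<or> i = m+2" for i by auto
    with 4 show ?case by (auto simp: labelings_def PiE_def extensional_def fun_eq_iff)
  qed
  then show ?thesis
    using bij_betw_same_card card_labelings[of "{1..m}" k] assms by fastforce
qed

lemma card_label_class:
  assumes "\<sigma> \<in> labelings m a1 a2 k"
  shows "card {i\<in>{1..m+2}. \<sigma> i = l} = nat (k l) + of_bool (a1 = l) + of_bool (a2 = l)"
proof -
  have "{i\<in>{1..m+2}. \<sigma> i = l} = {i\<in>{1..m}. \<sigma> i = l} \<union> ((if a1 = l then {m+1} else {}) \<union> (if a2 = l then {m+2} else {}))"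
    using assms by (auto simp: labelings_def le_Suc_eq)
  also have "card \<dots> = card {i\<in>{1..m}. \<sigma> i = l} + card ((if a1 = l then {m+1} else {}) \<union> (if a2 = l then {m+2} else {}))"
    by (rule card_Un_disjoint) auto
  also have "int (card {i\<in>{1..m}. \<sigma> i = l}) = k l"
    using assms by (simp add: labelings_def)
  then have "card {i\<in>{1..m}. \<sigma> i = l} = nat (k l)" by linarith
  finally show ?thesis by auto
qed

text \<open>When the constraints force the labelling to be \<open>lab\<close>, membership in the
  union over all labelings reduces to checking the class sizes of \<open>lab\<close>.\<close>

lemma ex_labeling_iff:
  assumes "\<And>\<sigma>. \<sigma> (m+1) = a1 \<and> \<sigma> (m+2) = a2 \<and> P \<sigma> \<longleftrightarrow> C \<and> (\<forall>i\<in>{1..m+2}. \<sigma> i = lab i)"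
  shows "(\<exists>\<sigma>\<in>labelings m a1 a2 k. P \<sigma>) \<longleftrightarrow> C \<and> (\<forall>l. int (card {i\<in>{1..m}. lab i = l}) = k l)"
proof -
  have eq: "{i\<in>{1..m}. \<sigma> i = l} = {i\<in>{1..m}. lab i = l}" if "\<forall>i\<in>{1..m+2}. \<sigma> i = lab i" for \<sigma> l
    using that by auto
  show ?thesis
  proof
    assume "\<exists>\<sigma>\<in>labelings m a1 a2 k. P \<sigma>"
    then obtain \<sigma> where \<sigma>: "\<sigma> \<in> labelings m a1 a2 k" "P \<sigma>" by blast
    with assms[of \<sigma>] have "C \<and> (\<forall>i\<in>{1..m+2}. \<sigma> i = lab i)" by (simp add: labelings_def)
    with \<sigma> eq[of \<sigma>] show "C \<and> (\<forall>l. int (card {i\<in>{1..m}. lab i = l}) = k l)"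
      by (simp add: labelings_def)
  next
    assume *: "C \<and> (\<forall>l. int (card {i\<in>{1..m}. lab i = l}) = k l)"
    define \<sigma> where "\<sigma> = restrict lab {1..m+2}"
    have \<sigma>: "\<forall>i\<in>{1..m+2}. \<sigma> i = lab i" "\<sigma> \<in> {1..m+2} \<rightarrow>\<^sub>E UNIV" by (auto simp: \<sigma>_def)
    with * assms[of \<sigma>] have "\<sigma> (m+1) = a1 \<and> \<sigma> (m+2) = a2 \<and> P \<sigma>" by blast
    with \<sigma> * eq[of \<sigma>] have "\<sigma> \<in> labelings m a1 a2 k" "P \<sigma>" by (simp_all add: labelings_def)
    then show "\<exists>\<sigma>\<in>labelings m a1 a2 k. P \<sigma>" by blast
  qed
qed

section \<open>Probability of a family of labellings with prescribed class sizes\<close>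

context dp_hash
begin

definition hash_at :: "'v omega \<Rightarrow> nat \<Rightarrow> nat" where
  "hash_at \<omega> i = snd (snd (snd \<omega>)) (atom_index \<omega> i)"

definition label_event :: "'l set \<Rightarrow> ('l \<Rightarrow> nat set) \<Rightarrow> nat set \<Rightarrow> (nat \<Rightarrow> 'l) \<Rightarrow> 'v omega set" where
  "label_event D T I \<sigma> = {\<omega> \<in> space M. label_compat D \<sigma> I (atom_index \<omega>) \<and> (\<forall>i\<in>I. hash_at \<omega> i \<in> T (\<sigma> i))}"

definition label_mass :: "('l \<Rightarrow> nat set) \<Rightarrow> 'l \<Rightarrow> real" where
  "label_mass T l = \<theta> * measure_pmf.prob hpmf (T l)"

lemma label_event_sets: "finite I \<Longrightarrow> label_event D T I \<sigma> \<in> sets M"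
  unfolding label_event_def hash_at_def by (rule emeasure_label_event)

lemma measure_label_event:
  fixes \<sigma> :: "nat \<Rightarrow> 'l :: finite"
  assumes I: "finite I"
    and disj: "\<And>l l'. l \<notin> D \<Longrightarrow> l' \<notin> D \<Longrightarrow> l \<noteq> l' \<Longrightarrow> T l \<inter> T l' = {}"
  shows "measure M (label_event D T I \<sigma>)
    = (\<Prod>l\<in>UNIV. label_weight D (label_mass T) l (card {i\<in>I. \<sigma> i = l})) / pochhammer \<theta> (card I)"
proof -
  have mass: "label_mass T = (\<lambda>l. \<theta> * measure_pmf.prob hpmf (T l))"
    by (simp add: label_mass_def fun_eq_iff)
  have "0 \<le> label_weight D (label_mass T) l k" for l k
    using \<theta> by (auto simp: label_weight_def label_mass_def pochhammer_prod intro!: prod_nonneg)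
  moreover have "0 < pochhammer \<theta> (card I)" using \<theta> by (rule pochhammer_pos)
  ultimately have "0 \<le> (\<Prod>l\<in>UNIV. label_weight D (label_mass T) l (card {i\<in>I. \<sigma> i = l})) / pochhammer \<theta> (card I)"
    by (intro divide_nonneg_pos prod_nonneg) auto
  moreover have "emeasure M (label_event D T I \<sigma>)
    = ennreal ((\<Prod>l\<in>UNIV. label_weight D (label_mass T) l (card {i\<in>I. \<sigma> i = l})) / pochhammer \<theta> (card I))"
    unfolding label_event_def hash_at_def emeasure_label_event(2)[OF I] mass
    by (rule label_sum_eq[OF \<theta> I disj])
  ultimately show ?thesis by (simp add: measure_def)
qed

text \<open>The events are disjoint and equally likely, since their probability depends on class
  sizes only, so it suffices to multiply by their number. By \<open>ded\<close> every dedicated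
  label that can occur is anchored at one of the two new samples; without an anchor, renaming a
  block could describe the same outcome twice.\<close>

lemma measure_labelings:
  fixes k :: "'l :: finite \<Rightarrow> int"
  assumes disj: "\<And>l l'. l \<notin> D \<Longrightarrow> l' \<notin> D \<Longrightarrow> l \<noteq> l' \<Longrightarrow> T l \<inter> T l' = {}"
    and ded: "\<And>l. l \<in> D \<Longrightarrow> l = a1 \<or> l = a2 \<or> T l = {}"
    and k: "(\<Sum>l\<in>UNIV. k l) = int m"
  shows "measure M (\<Union>\<sigma>\<in>labelings m a1 a2 k. label_event D T {1..m+2} \<sigma>)
    = fact m / pochhammer \<theta> (m + 2) *
      (\<Prod>l\<in>UNIV. inv_fact (k l) * label_weight D (label_mass T) l (nat (k l) + of_bool (a1 = l) + of_bool (a2 = l)))"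
proof -
  interpret prob_space M by (rule prob_space_M)
  let ?E = "label_event D T {1..m+2}"
  have fin: "finite (labelings m a1 a2 k)"
    unfolding labelings_def by (rule finite_subset[OF _ finite_PiE[of "{1..m+2}" "\<lambda>_. UNIV"]]) auto
  have "disjoint_family_on ?E (labelings m a1 a2 k)"
    unfolding disjoint_family_on_def
  proof (intro ballI impI, rule ccontr)
    fix \<sigma> \<sigma>' assume \<sigma>: "\<sigma> \<in> labelings m a1 a2 k" "\<sigma>' \<in> labelings m a1 a2 k" "\<sigma> \<noteq> \<sigma>'"
      and "?E \<sigma> \<inter> ?E \<sigma>' \<noteq> {}"
    then obtain \<omega> where \<omega>: "\<omega> \<in> ?E \<sigma>" "\<omega> \<in> ?E \<sigma>'" by blast
    \<comment> \<open>The anchor \<open>r\<close> carries the same dedicated label in both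
      labellings. Sample \<open>i\<close> shares its atom by the first labelling, hence its label by
      the second.\<close>
    have ded_eq: "\<tau> i = \<tau>' i"
      if \<tau>: "\<tau> \<in> labelings m a1 a2 k" "\<tau>' \<in> labelings m a1 a2 k" "\<omega> \<in> ?E \<tau>" "\<omega> \<in> ?E \<tau>'"
        and i: "i \<in> {1..m+2}" "\<tau> i \<in> D" for i \<tau> \<tau>'
    proof -
      have "T (\<tau> i) \<noteq> {}" using \<tau>(3) i(1) unfolding label_event_def by blast
      with ded[OF i(2)] have "\<tau> i = a1 \<or> \<tau> i = a2" by blast
      moreover have "\<tau> (m+1) = a1" "\<tau>' (m+1) = a1" "\<tau> (m+2) = a2" "\<tau>' (m+2) = a2"
        using \<tau>(1,2) by (simp_all add: labelings_def)
      moreover have "m+1 \<in> {1..m+2}" "m+2 \<in> {1..m+2}" by simp_all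
      ultimately obtain r where r: "r \<in> {1..m+2}" "\<tau> r = \<tau> i" "\<tau>' r = \<tau> i"
        by metis
      then have "atom_index \<omega> r = atom_index \<omega> i"
        using \<tau>(3) i unfolding label_event_def label_compat_def by auto
      moreover have "atom_index \<omega> r = atom_index \<omega> i \<longleftrightarrow> \<tau>' r = \<tau>' i"
        using \<tau>(4) i r unfolding label_event_def label_compat_def mem_Collect_eq by metis
      ultimately show ?thesis using r by simp
    qed
    have "\<sigma> i = \<sigma>' i" if i: "i \<in> {1..m+2}" for i
    proof (cases "\<sigma> i \<in> D \<or> \<sigma>' i \<in> D")
      case True
      then show ?thesis
        using ded_eq[OF \<sigma>(1,2) \<omega> i] ded_eq[OF \<sigma>(2,1) \<omega>(2,1) i] by metis
    next
      case False
      have "hash_at \<omega> i \<in> T (\<sigma> i)" "hash_at \<omega> i \<in> T (\<sigma>' i)"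
        using \<omega> i unfolding label_event_def by blast+
      then have "T (\<sigma> i) \<inter> T (\<sigma>' i) \<noteq> {}" by blast
      then show ?thesis using disj[of "\<sigma> i" "\<sigma>' i"] False by metis
    qed
    moreover have "\<sigma> \<in> {1..m+2} \<rightarrow>\<^sub>E UNIV" "\<sigma>' \<in> {1..m+2} \<rightarrow>\<^sub>E UNIV"
      using \<sigma> by (simp_all add: labelings_def)
    ultimately have "\<sigma> = \<sigma>'" by (metis PiE_ext)
    with \<sigma>(3) show False by simp
  qed
  then have "measure M (\<Union>\<sigma>\<in>labelings m a1 a2 k. ?E \<sigma>) = (\<Sum>\<sigma>\<in>labelings m a1 a2 k. measure M (?E \<sigma>))"
    using fin by (intro finite_measure_finite_Union) (auto intro!: label_event_sets)
  also have "\<dots> = (\<Sum>\<sigma>\<in>labelings m a1 a2 k.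
    (\<Prod>l\<in>UNIV. label_weight D (label_mass T) l (nat (k l) + of_bool (a1 = l) + of_bool (a2 = l))) / pochhammer \<theta> (m + 2))"
  proof (intro sum.cong refl)
    fix \<sigma> assume \<sigma>: "\<sigma> \<in> labelings m a1 a2 k"
    have "measure M (?E \<sigma>) = (\<Prod>l\<in>UNIV. label_weight D (label_mass T) l (card {i\<in>{1..m+2}. \<sigma> i = l})) / pochhammer \<theta> (card {1..m+2})"
      by (rule measure_label_event[OF _ disj]) auto
    then show "measure M (?E \<sigma>) =
      (\<Prod>l\<in>UNIV. label_weight D (label_mass T) l (nat (k l) + of_bool (a1 = l) + of_bool (a2 = l))) / pochhammer \<theta> (m + 2)"
      unfolding card_label_class[OF \<sigma>] by (simp only: card_atLeastAtMost) simp
  qed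
  also have "\<dots> = fact m * (\<Prod>l\<in>UNIV. inv_fact (k l)) *
    ((\<Prod>l\<in>UNIV. label_weight D (label_mass T) l (nat (k l) + of_bool (a1 = l) + of_bool (a2 = l))) / pochhammer \<theta> (m + 2))"
    by (simp add: real_card_labelings[OF k])
  finally show ?thesis by (simp add: prod.distrib)
qed

lemma AE_Xobs: "AE \<omega> in M. \<forall>i k. (Xobs \<omega> i = Xobs \<omega> k \<longleftrightarrow> atom_index \<omega> i = atom_index \<omega> k)
   \<and> hash \<omega> (Xobs \<omega> i) = hash_at \<omega> i"
  using AE_inj_locations by eventually_elim (simp add: Xobs_eq_iff hash_Xobs hash_at_def)

lemma AE_hash_range:
  assumes "J \<ge> 1" shows "AE \<omega> in M. \<forall>i. hash_at \<omega> i \<in> {1..J}"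
proof -
  have "AE h in hashes hpmf. \<forall>j. h j \<in> {1..J}"
  proof -
    interpret P: sequence_space "measure_pmf hpmf" by standard
    have "AE h in hashes hpmf. h j \<in> {1..J}" for j
    proof -
      have "AE x in distr (hashes hpmf) (measure_pmf hpmf) (\<lambda>h. h j). x \<in> {1..J}"
        by (subst P.PiM_component) (use assms in \<open>auto simp: AE_measure_pmf_iff\<close>)
      then show ?thesis by (subst (asm) AE_distr_iff) auto
    qed
    then show ?thesis by (simp add: AE_all_countable)
  qed
  \<comment> \<open>The marginal law of the hash values comes from the joint formula with no samples
    at all, where \<open>atom_prob\<close> is one.\<close>
  moreover have "distr M (hashes hpmf) (\<lambda>\<omega>. snd (snd (snd \<omega>))) = hashes hpmf"
  proof -
    interpret prob_space M by (rule prob_space_M)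
    show ?thesis
    proof (rule measure_eqI)
      fix A assume "A \<in> sets (distr M (hashes hpmf) (\<lambda>\<omega>. snd (snd (snd \<omega>))))"
      then have A: "A \<in> sets (hashes hpmf)" by simp
      have "emeasure (distr M (hashes hpmf) (\<lambda>\<omega>. snd (snd (snd \<omega>)))) A
        = emeasure M {\<omega> \<in> space M. (\<forall>i\<in>{}. atom_index \<omega> i = 0) \<and> snd (snd (snd \<omega>)) \<in> A}"
        unfolding emeasure_distr[OF measurable_components(4) A] by (intro arg_cong[where f = "emeasure M"]) auto
      also have "\<dots> = emeasure (hashes hpmf) A"
        using emeasure_atoms_hashes(2)[OF _ A, of "{}" "\<lambda>_. 0"] prob_space.emeasure_space_1[OF prob_space_parts(4)]
        by (simp add: atom_prob_def)
      finally show "emeasure (distr M (hashes hpmf) (\<lambda>\<omega>. snd (snd (snd \<omega>)))) A = emeasure (hashes hpmf) A" .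
    qed simp
  qed
  ultimately have "AE h in distr M (hashes hpmf) (\<lambda>\<omega>. snd (snd (snd \<omega>))). \<forall>j. h j \<in> {1..J}" by (simp only:)
  then have "AE \<omega> in M. \<forall>j. snd (snd (snd \<omega>)) j \<in> {1..J}"
    by (rule AE_distrD[OF measurable_components(4)])
  then show ?thesis by eventually_elim (simp add: hash_at_def)
qed

end

section \<open>The two events\<close>

text \<open>\<open>A1\<close>, \<open>A2\<close> are the blocks of \<open>X\<^bsub>m+1\<^esub>\<close>, \<open>X\<^bsub>m+2\<^esub>\<close>; \<open>B1\<close>, \<open>B2\<close> are the other samples
in their buckets, and \<open>R\<close> is the rest. If the two blocks or the two buckets coincide, only the label
with index 1 is used.\<close>

datatype label = A1 | A2 | B1 | B2 | R

lemma UNIV_label: "UNIV = {A1, A2, B1, B2, R}"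
  by (auto intro: label.exhaust)

instance label :: finite
  by standard (simp add: UNIV_label)

lemma all_label: "(\<forall>l. P l) \<longleftrightarrow> P A1 \<and> P A2 \<and> P B1 \<and> P B2 \<and> P R"
  by (metis label.exhaust)

lemma sum_label: "(\<Sum>l\<in>UNIV. f l) = f A1 + (f A2 + (f B1 + (f B2 + f R)))"
  by (simp add: UNIV_label)

lemma prod_label: "(\<Prod>l\<in>UNIV. f l) = f A1 * (f A2 * (f B1 * (f B2 * f R)))"
  by (simp add: UNIV_label)

definition count_label :: "int \<Rightarrow> int \<Rightarrow> int \<Rightarrow> int \<Rightarrow> int \<Rightarrow> label \<Rightarrow> int" where
  "count_label a a' b b' r l = (case l of A1 \<Rightarrow> a | A2 \<Rightarrow> a' | B1 \<Rightarrow> b | B2 \<Rightarrow> b' | R \<Rightarrow> r)"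

text \<open>An empty set forbids a label: \<open>A2\<close> when the two new samples share an atom
  (\<open>e\<close>), \<open>B2\<close> when their buckets agree. The sets of \<open>B1\<close>,
  \<open>B2\<close> and \<open>R\<close> are always disjoint and cover all hash values.\<close>

definition num_T :: "bool \<Rightarrow> nat \<Rightarrow> nat \<Rightarrow> label \<Rightarrow> nat set" where
  "num_T e b1 b2 l = (case l of A1 \<Rightarrow> {b1} | A2 \<Rightarrow> (if e then {} else {b2})
     | B1 \<Rightarrow> {b1} | B2 \<Rightarrow> {b2} - {b1} | R \<Rightarrow> - {b1, b2})"

definition num_label :: "nat \<Rightarrow> (nat \<Rightarrow> nat) \<Rightarrow> (nat \<Rightarrow> nat) \<Rightarrow> nat \<Rightarrow> nat \<Rightarrow> nat \<Rightarrow> label" where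
  "num_label m \<kappa> h b1 b2 i = (if \<kappa> i = \<kappa> (m+1) then A1 else if \<kappa> i = \<kappa> (m+2) then A2
     else if h i = b1 then B1 else if h i = b2 then B2 else R)"

definition den_T :: "nat \<Rightarrow> nat \<Rightarrow> label \<Rightarrow> nat set" where
  "den_T b1 b2 l = (case l of A1 \<Rightarrow> {} | A2 \<Rightarrow> {} | B1 \<Rightarrow> {b1} | B2 \<Rightarrow> {b2} - {b1} | R \<Rightarrow> - {b1, b2})"

definition den_label :: "(nat \<Rightarrow> nat) \<Rightarrow> nat \<Rightarrow> nat \<Rightarrow> nat \<Rightarrow> label" where
  "den_label h b1 b2 i = (if h i = b1 then B1 else if h i = b2 then B2 else R)"

text \<open>The sets of \<open>B1\<close>, \<open>B2\<close>, \<open>R\<close> partition the hash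
  values and those of \<open>A1\<close>, \<open>A2\<close> are empty, so the hash values alone
  determine the labelling and compatibility is automatic.\<close>

lemma den_label_iff:
  assumes "a2 = (if b1 = b2 then B1 else B2)"
  shows "\<sigma> (m+1) = B1 \<and> \<sigma> (m+2) = a2 \<and> label_compat {A1, A2} \<sigma> {1..m+2} \<kappa> \<and> (\<forall>i\<in>{1..m+2}. h i \<in> den_T b1 b2 (\<sigma> i))
    \<longleftrightarrow> (h (m+1) = b1 \<and> h (m+2) = b2) \<and> (\<forall>i\<in>{1..m+2}. \<sigma> i = den_label h b1 b2 i)"
proof -
  have T: "h i \<in> den_T b1 b2 l \<longleftrightarrow> l = den_label h b1 b2 i" for i l
    by (cases l) (auto simp: den_T_def den_label_def)
  have I: "m+1 \<in> {1..m+2}" "m+2 \<in> {1..m+2}" by auto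
  have B: "B1 = den_label h b1 b2 i \<longleftrightarrow> h i = b1" "a2 = den_label h b1 b2 i \<longleftrightarrow> h i = b2" for i
    using assms by (auto simp: den_label_def)
  have "label_compat {A1, A2} \<sigma> {1..m+2} \<kappa>" if "\<forall>i\<in>{1..m+2}. \<sigma> i = den_label h b1 b2 i"
    using that by (auto simp: label_compat_def den_label_def split: if_splits)
  then show ?thesis unfolding T using I B by metis
qed

text \<open>The anchors decide which samples are dedicated, namely those on the atom of a new
  sample; the hash values decide the rest. By \<open>hk\<close>, a sample on the atom of an anchor
  also has its hash value.\<close>

lemma num_label_iff:
  assumes hk: "\<And>i i'. \<kappa> i = \<kappa> i' \<Longrightarrow> h i = h i'" and a2: "a2 = (if e then A1 else A2)" and e: "e \<Longrightarrow> b1 = b2"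
  shows "\<sigma> (m+1) = A1 \<and> \<sigma> (m+2) = a2 \<and> label_compat {A1, A2} \<sigma> {1..m+2} \<kappa> \<and> (\<forall>i\<in>{1..m+2}. h i \<in> num_T e b1 b2 (\<sigma> i))
    \<longleftrightarrow> (h (m+1) = b1 \<and> h (m+2) = b2 \<and> (\<kappa> (m+1) = \<kappa> (m+2)) = e) \<and> (\<forall>i\<in>{1..m+2}. \<sigma> i = num_label m \<kappa> h b1 b2 i)"
    (is "?L \<longleftrightarrow> ?C \<and> ?R")
proof -
  have I: "m+1 \<in> {1..m+2}" "m+2 \<in> {1..m+2}" by auto
  show ?thesis
  proof
    assume L: ?L
    then have s: "\<sigma> (m+1) = A1" "\<sigma> (m+2) = a2" by simp_all
    have T: "h i \<in> num_T e b1 b2 (\<sigma> i)" if "i \<in> {1..m+2}" for i using L that by blast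
    have c: "\<kappa> i = \<kappa> i' \<longleftrightarrow> \<sigma> i = \<sigma> i'" if "i \<in> {1..m+2}" "i' \<in> {1..m+2}" "\<sigma> i \<in> {A1, A2}" for i i'
      using L that unfolding label_compat_def by blast
    have C: ?C
      using T[OF I(1)] T[OF I(2)] c[OF I] s a2 e by (auto simp: num_T_def split: if_splits)
    have "\<sigma> i = num_label m \<kappa> h b1 b2 i" if i: "i \<in> {1..m+2}" for i
    proof -
      have 1: "\<kappa> i = \<kappa> (m+1) \<longleftrightarrow> \<sigma> i = A1"
        using c[OF I(1) i] s(1) by (simp add: eq_commute)
      have 2: "\<kappa> i = \<kappa> (m+2) \<longleftrightarrow> \<sigma> i = a2"
      proof -
        have "\<sigma> (m+2) \<in> {A1, A2}" using s(2) a2 by simp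
        from c[OF I(2) i this] show ?thesis unfolding s(2) by metis
      qed
      show ?thesis
        using T[OF i] unfolding num_label_def 1 2 a2
        by (cases "\<sigma> i") (auto simp: num_T_def split: if_splits)
    qed
    with C show "?C \<and> ?R" by blast
  next
    assume R: "?C \<and> ?R"
    then have \<sigma>: "\<sigma> i = num_label m \<kappa> h b1 b2 i" if "i \<in> {1..m+2}" for i using that by blast
    have lab: "num_label m \<kappa> h b1 b2 i = A1 \<longleftrightarrow> \<kappa> i = \<kappa> (m+1)"
      "num_label m \<kappa> h b1 b2 i = A2 \<longleftrightarrow> \<kappa> i = \<kappa> (m+2) \<and> \<not> e" for i
      using R by (auto simp: num_label_def)
    have "label_compat {A1, A2} \<sigma> {1..m+2} \<kappa>"
      unfolding label_compat_def
    proof (intro ballI impI)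
      fix i i' assume i: "i \<in> {1..m+2}" "i' \<in> {1..m+2}" "\<sigma> i \<in> {A1, A2}"
      then show "\<kappa> i = \<kappa> i' \<longleftrightarrow> \<sigma> i = \<sigma> i'"
        using lab[of i] lab[of i'] unfolding \<sigma>[OF i(1)] \<sigma>[OF i(2)] by auto
    qed
    moreover have "h i \<in> num_T e b1 b2 (num_label m \<kappa> h b1 b2 i)" for i
      using R hk[of i "m+1"] hk[of i "m+2"] by (auto simp: num_T_def num_label_def)
    moreover have "\<sigma> (m+1) = A1" "\<sigma> (m+2) = a2"
      using R a2 unfolding \<sigma>[OF I(1)] \<sigma>[OF I(2)] by (auto simp: num_label_def)
    ultimately show ?L using \<sigma> by simp
  qed
qed

lemma card_disjoint_pair: "finite A \<Longrightarrow> card {i\<in>A. P i \<or> Q i} = card {i\<in>A. P i} + card {i\<in>A. Q i}"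
  if "\<And>i. \<not> (P i \<and> Q i)"
proof -
  assume "finite A"
  moreover have "{i\<in>A. P i \<or> Q i} = {i\<in>A. P i} \<union> {i\<in>A. Q i}" by auto
  ultimately show ?thesis using that by (simp only:) (subst card_Un_disjoint, auto)
qed

text \<open>The size of \<open>R\<close> is forced by the total \<open>m\<close>. If the prescribed
  size of \<open>R\<close> is negative, both sides fail.\<close>

lemma den_counts:
  fixes h :: "nat \<Rightarrow> nat"
  assumes "h (m+1) = b1" "h (m+2) = b2"
  shows "(\<forall>l. int (card {i\<in>{1..m}. den_label h b1 b2 i = l})
      = (if b1 = b2 then count_label 0 0 (int c1) 0 (int m - int c1)
         else count_label 0 0 (int c1) (int c2) (int m - int c1 - int c2)) l)
    \<longleftrightarrow> card {i\<in>{1..m}. h i = h (m+1)} = c1 \<and> (b1 \<noteq> b2 \<longrightarrow> card {i\<in>{1..m}. h i = h (m+2)} = c2)"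
proof -
  let ?N = "\<lambda>l. card {i\<in>{1..m}. den_label h b1 b2 i = l}"
  have tot: "?N A1 + (?N A2 + (?N B1 + (?N B2 + ?N R))) = m"
    using sum_card_labels[of "{1..m}" "den_label h b1 b2"] unfolding sum_label by simp
  have 0: "?N A1 = 0" "?N A2 = 0"
    by (auto simp: den_label_def)
  have B1: "card {i\<in>{1..m}. h i = h (m+1)} = ?N B1"
    using assms by (intro arg_cong[where f = card]) (auto simp: den_label_def)
  have B2: "?N B2 = (if b1 = b2 then 0 else card {i\<in>{1..m}. h i = h (m+2)})"
    using assms by (auto simp: den_label_def intro!: arg_cong[where f = card])
  define N where "N l = ?N l" for l
  define d1 d2 where "d1 = card {i\<in>{1..m}. h i = h (m+1)}" and "d2 = card {i\<in>{1..m}. h i = h (m+2)}"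
  note folds = N_def[symmetric] d1_def[symmetric] d2_def[symmetric]
  show ?thesis
    using tot 0 B1 B2 unfolding folds all_label count_label_def by auto
qed

text \<open>The bucket of the first new sample consists of \<open>A1\<close>, \<open>B1\<close> and,
  if both new samples lie in one bucket on different atoms, also \<open>A2\<close>. Hence the size
  of \<open>B1\<close> is \<open>c1 - l1\<close> or \<open>c1 - l1 - l2\<close>, the two kinds of
  index occurring in \<open>Num\<close>.\<close>

lemma num_counts:
  fixes h :: "nat \<Rightarrow> nat"
  assumes hk: "\<And>i i'. \<kappa> i = \<kappa> i' \<Longrightarrow> h i = h i'" and C: "h (m+1) = b1" "h (m+2) = b2" "(\<kappa> (m+1) = \<kappa> (m+2)) = e"
  shows "(\<forall>l. int (card {i\<in>{1..m}. num_label m \<kappa> h b1 b2 i = l})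
      = (if e then count_label (int l1) 0 (int c1 - int l1) 0 (int m - int c1)
         else if b1 = b2 then count_label (int l1) (int l2) (int c1 - int l1 - int l2) 0 (int m - int c1)
         else count_label (int l1) (int l2) (int c1 - int l1) (int c2 - int l2) (int m - int c1 - int c2)) l)
    \<longleftrightarrow> card {i\<in>{1..m}. \<kappa> i = \<kappa> (m+1)} = l1 \<and> (\<not> e \<longrightarrow> card {i\<in>{1..m}. \<kappa> i = \<kappa> (m+2)} = l2) \<and>
      card {i\<in>{1..m}. h i = h (m+1)} = c1 \<and> (b1 \<noteq> b2 \<longrightarrow> card {i\<in>{1..m}. h i = h (m+2)} = c2)"
proof -
  let ?lab = "num_label m \<kappa> h b1 b2"
  let ?N = "\<lambda>l. card {i\<in>{1..m}. ?lab i = l}"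
  have tot: "?N A1 + (?N A2 + (?N B1 + (?N B2 + ?N R))) = m"
    using sum_card_labels[of "{1..m}" ?lab] unfolding sum_label by simp
  have A1: "card {i\<in>{1..m}. \<kappa> i = \<kappa> (m+1)} = ?N A1"
    by (intro arg_cong[where f = card]) (auto simp: num_label_def)
  have A2: "?N A2 = (if e then 0 else card {i\<in>{1..m}. \<kappa> i = \<kappa> (m+2)})"
    using C by (auto simp: num_label_def intro!: arg_cong[where f = card])
  have h_lab: "h i = b1 \<longleftrightarrow> (?lab i = A1 \<or> b1 = b2 \<and> ?lab i = A2) \<or> ?lab i = B1"
    "b1 \<noteq> b2 \<Longrightarrow> h i = b2 \<longleftrightarrow> ?lab i = A2 \<or> ?lab i = B2" for i
  proof -
    consider "\<kappa> i = \<kappa> (m+1)" "h i = b1" | "\<kappa> i \<noteq> \<kappa> (m+1)" "\<kappa> i = \<kappa> (m+2)" "h i = b2"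
      | "\<kappa> i \<noteq> \<kappa> (m+1)" "\<kappa> i \<noteq> \<kappa> (m+2)"
      using hk C by metis
    then show "h i = b1 \<longleftrightarrow> (?lab i = A1 \<or> b1 = b2 \<and> ?lab i = A2) \<or> ?lab i = B1"
      "b1 \<noteq> b2 \<Longrightarrow> h i = b2 \<longleftrightarrow> ?lab i = A2 \<or> ?lab i = B2"
      by (cases; auto simp: num_label_def)+
  qed
  have set1: "{i\<in>{1..m}. h i = h (m+1)} = {i\<in>{1..m}. (?lab i = A1 \<or> b1 = b2 \<and> ?lab i = A2) \<or> ?lab i = B1}"
    unfolding C by (simp only: h_lab(1))
  have card1: "card {i\<in>{1..m}. (?lab i = A1 \<or> b1 = b2 \<and> ?lab i = A2) \<or> ?lab i = B1}
    = card {i\<in>{1..m}. ?lab i = A1 \<or> b1 = b2 \<and> ?lab i = A2} + ?N B1"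
    by (rule card_disjoint_pair) auto
  have card2: "card {i\<in>{1..m}. ?lab i = A1 \<or> b1 = b2 \<and> ?lab i = A2} = ?N A1 + (if b1 = b2 then ?N A2 else 0)"
  proof (cases "b1 = b2")
    case True
    have "card {i\<in>{1..m}. ?lab i = A1 \<or> ?lab i = A2} = ?N A1 + ?N A2"
      by (rule card_disjoint_pair) auto
    with True show ?thesis by simp
  qed simp
  have B1: "card {i\<in>{1..m}. h i = h (m+1)} = ?N A1 + (if b1 = b2 then ?N A2 else 0) + ?N B1"
    unfolding set1 card1 card2 ..
  have B2: "card {i\<in>{1..m}. h i = h (m+2)} = ?N A2 + ?N B2" if "b1 \<noteq> b2"
  proof -
    have set2: "{i\<in>{1..m}. h i = h (m+2)} = {i\<in>{1..m}. ?lab i = A2 \<or> ?lab i = B2}"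
      unfolding C by (simp only: h_lab(2)[OF that])
    show ?thesis
      unfolding set2 by (rule card_disjoint_pair) auto
  qed
  have B2': "?N B2 = 0" if "b1 = b2"
    using that by (auto simp: num_label_def)
  have "e \<Longrightarrow> b1 = b2" using C hk by metis
  define N where "N l = ?N l" for l
  define f1 f2 where "f1 = card {i\<in>{1..m}. \<kappa> i = \<kappa> (m+1)}" and "f2 = card {i\<in>{1..m}. \<kappa> i = \<kappa> (m+2)}"
  define d1 d2 where "d1 = card {i\<in>{1..m}. h i = h (m+1)}" and "d2 = card {i\<in>{1..m}. h i = h (m+2)}"
  note folds = N_def[symmetric] f1_def[symmetric] f2_def[symmetric] d1_def[symmetric] d2_def[symmetric]
  show ?thesis
    using \<open>e \<Longrightarrow> b1 = b2\<close> tot A1 A2 B1 B2 B2' unfolding folds all_label count_label_def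
    by (cases e; cases "b1 = b2") auto
qed

lemma inv_fact_pochhammer: "inv_fact k * pochhammer x (nat k) = pf x k"
  by (simp add: inv_fact_def pf_def)

text \<open>The probabilities depend on the two hash values only through their equality; this
  produces the factors \<open>J\<close> and \<open>J * (J - 1)\<close>.\<close>

lemma sum_diag_offdiag:
  fixes p q :: real
  shows "(\<Sum>b1\<in>{1..J::nat}. \<Sum>b2\<in>{1..J}. if b1 = b2 then p else q) = real J * p + real J * (real J - 1) * q"
proof (cases "J = 0")
  case False
  have "(\<Sum>b2\<in>{1..J}. if b1 = b2 then p else q) = p + (real J - 1) * q" if "b1 \<in> {1..J}" for b1
  proof -
    have "(\<Sum>b2\<in>{1..J}. if b1 = b2 then p else q) = p + (\<Sum>b2\<in>{1..J} - {b1}. if b1 = b2 then p else q)"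
      using that by (subst sum.remove[of _ b1]) auto
    also have "(\<Sum>b2\<in>{1..J} - {b1}. if b1 = b2 then p else q) = (\<Sum>b2\<in>{1..J} - {b1}. q)"
      by (intro sum.cong) auto
    also have "\<dots> = (real J - 1) * q"
      using that False by (simp add: of_nat_diff)
    finally show ?thesis .
  qed
  then have "(\<Sum>b1\<in>{1..J}. \<Sum>b2\<in>{1..J}. if b1 = b2 then p else q) = (\<Sum>b1\<in>{1..J}. p + (real J - 1) * q)"
    by (intro sum.cong refl)
  then show ?thesis by (simp add: algebra_simps)
qed simp

lemma (in prob_space) measure_eq_sum_AE:
  assumes X: "\<And>b. b \<in> B \<Longrightarrow> {\<omega> \<in> space M. P \<omega> \<and> f \<omega> = b} \<in> events" "{\<omega> \<in> space M. P \<omega>} \<in> events"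
    and B: "finite B" "AE \<omega> in M. f \<omega> \<in> B"
  shows "prob {\<omega> \<in> space M. P \<omega>} = (\<Sum>b\<in>B. prob {\<omega> \<in> space M. P \<omega> \<and> f \<omega> = b})"
proof -
  have "prob {\<omega> \<in> space M. P \<omega>} = prob (\<Union>b\<in>B. {\<omega> \<in> space M. P \<omega> \<and> f \<omega> = b})"
  proof (rule measure_eq_AE)
    show "AE \<omega> in M. (\<omega> \<in> {\<omega> \<in> space M. P \<omega>}) = (\<omega> \<in> (\<Union>b\<in>B. {\<omega> \<in> space M. P \<omega> \<and> f \<omega> = b}))"
      using B(2) by eventually_elim auto
  qed (use X B in \<open>auto intro!: sets.finite_UN\<close>)
  also have "\<dots> = (\<Sum>b\<in>B. prob {\<omega> \<in> space M. P \<omega> \<and> f \<omega> = b})"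
    by (rule finite_measure_finite_Union) (use X B in \<open>auto simp: disjoint_family_on_def\<close>)
  finally show ?thesis .
qed

section \<open>Probabilities of the pieces and summation over hash values\<close>

context dp_hash
begin

abbreviation (input) "a \<equiv> \<theta> / real J"

lemma label_mass_singleton:
  assumes "b \<in> {1..J}" "T l = {b}"
  shows "label_mass T l = a"
proof -
  have "{1..J} \<inter> {b} = {b}" using assms by auto
  with assms show ?thesis by (simp add: label_mass_def measure_pmf_of_set)
qed

lemma label_mass_compl:
  assumes "T l = - S" "S \<subseteq> {1..J}" "J \<ge> 1"
  shows "label_mass T l = \<theta> - real (card S) * a"
proof -
  have "{1..J} \<inter> - S = {1..J} - S" by auto
  moreover have "card ({1..J} - S) = J - card S" "card S \<le> J"
    using assms card_mono[of "{1..J}" S] by (auto simp: card_Diff_subset finite_subset)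
  ultimately show ?thesis using assms
    by (simp add: label_mass_def measure_pmf_of_set of_nat_diff field_simps)
qed

lemma AE_counts: "AE \<omega> in M. (\<forall>i k. Xobs \<omega> i = Xobs \<omega> k \<longleftrightarrow> atom_index \<omega> i = atom_index \<omega> k)
  \<and> (\<forall>i. hash \<omega> (Xobs \<omega> i) = hash_at \<omega> i)
  \<and> (\<forall>r. freq m \<omega> r = card {i\<in>{1..m}. atom_index \<omega> i = atom_index \<omega> (m+r)})
  \<and> (\<forall>r. bucket m \<omega> r = card {i\<in>{1..m}. hash_at \<omega> i = hash_at \<omega> (m+r)})"
  using AE_Xobs by eventually_elim (simp add: freq_def bucket_def)

definition num_part :: "nat \<Rightarrow> nat \<Rightarrow> nat \<Rightarrow> nat \<Rightarrow> nat \<Rightarrow> nat \<times> nat \<times> bool \<Rightarrow> 'v omega set" where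
  "num_part m l1 l2 c1 c2 b = {\<omega> \<in> space M.
     (freq m \<omega> 1 = l1 \<and> freq m \<omega> 2 = l2 \<and> bucket m \<omega> 1 = c1 \<and> bucket m \<omega> 2 = c2) \<and>
     (hash \<omega> (Xobs \<omega> (m+1)), hash \<omega> (Xobs \<omega> (m+2)), Xobs \<omega> (m+1) = Xobs \<omega> (m+2)) = b}"

definition den_part :: "nat \<Rightarrow> nat \<Rightarrow> nat \<Rightarrow> nat \<times> nat \<Rightarrow> 'v omega set" where
  "den_part m c1 c2 b = {\<omega> \<in> space M. (bucket m \<omega> 1 = c1 \<and> bucket m \<omega> 2 = c2) \<and>
     (hash \<omega> (Xobs \<omega> (m+1)), hash \<omega> (Xobs \<omega> (m+2))) = b}"

lemma level_sets:
  "{\<omega> \<in> space M. freq m \<omega> r = n} \<in> sets M"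
  "{\<omega> \<in> space M. bucket m \<omega> r = n} \<in> sets M"
  "{\<omega> \<in> space M. hash \<omega> (Xobs \<omega> i) = n} \<in> sets M"
  "{\<omega> \<in> space M. (Xobs \<omega> i = Xobs \<omega> k) = e} \<in> sets M"
proof -
  have level: "{\<omega> \<in> space M. f \<omega> = n} \<in> sets M" if "f \<in> measurable M (count_space UNIV)" for f :: "'v omega \<Rightarrow> nat"
    using measurable_sets[OF that, of "{n}"] by (simp add: vimage_def Collect_conj_eq Int_commute)
  show "{\<omega> \<in> space M. freq m \<omega> r = n} \<in> sets M" "{\<omega> \<in> space M. bucket m \<omega> r = n} \<in> sets M"
    "{\<omega> \<in> space M. hash \<omega> (Xobs \<omega> i) = n} \<in> sets M"
    by (intro level measurable_freq measurable_bucket measurable_hash)+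
  have "Measurable.pred M (\<lambda>\<omega>. Xobs \<omega> i = Xobs \<omega> k)"
    by (intro measurable_eq measurable_Xobs)
  then show "{\<omega> \<in> space M. (Xobs \<omega> i = Xobs \<omega> k) = e} \<in> sets M"
    by (cases e) (auto simp: pred_def intro: sets.sets_Collect_neg)
qed

lemma num_part_sets: "num_part m l1 l2 c1 c2 b \<in> sets M"
  unfolding num_part_def
  by (cases b) (simp only: prod.inject, intro sets.sets_Collect_conj level_sets)

lemma den_part_sets: "den_part m c1 c2 b \<in> sets M"
  unfolding den_part_def
  by (cases b) (simp only: prod.inject, intro sets.sets_Collect_conj level_sets)

text \<open>In a common bucket both new samples carry \<open>B1\<close>, whose class then has
  \<open>c1 + 2\<close> members; otherwise \<open>B1\<close> and \<open>B2\<close> gain one each.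
  This accounts for the orders of the rising factorials in \<open>Den\<close>.\<close>

lemma measure_den_part:
  assumes J: "J \<ge> 1" and b: "b1 \<in> {1..J}" "b2 \<in> {1..J}"
  shows "measure M (den_part m c1 c2 (b1, b2)) = fact m / pochhammer \<theta> (m + 2) *
    (if b1 = b2 then (if c1 = c2 then pochhammer a (c1 + 2) / fact c1 * pf (\<theta> - a) (int m - int c1) else 0)
     else pochhammer a (c1 + 1) / fact c1 * (pochhammer a (c2 + 1) / fact c2) * pf (\<theta> - 2 * a) (int m - int c1 - int c2))"
proof -
  interpret prob_space M by (rule prob_space_M)
  define a2 where "a2 = (if b1 = b2 then B1 else B2)"
  define k where "k = (if b1 = b2 then count_label 0 0 (int c1) 0 (int m - int c1)
         else count_label 0 0 (int c1) (int c2) (int m - int c1 - int c2))"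
  let ?T = "den_T b1 b2"
  let ?U = "\<Union>\<sigma>\<in>labelings m B1 a2 k. label_event {A1, A2} ?T {1..m+2} \<sigma>"
  have U_sets: "?U \<in> sets M"
    unfolding labelings_def
    by (intro sets.finite_UN label_event_sets finite_subset[OF _ finite_PiE[of "{1..m+2}" "\<lambda>_. UNIV"]]) auto
  have U: "\<omega> \<in> ?U \<longleftrightarrow> (hash_at \<omega> (m+1) = b1 \<and> hash_at \<omega> (m+2) = b2) \<and>
      card {i\<in>{1..m}. hash_at \<omega> i = hash_at \<omega> (m+1)} = c1 \<and>
      (b1 \<noteq> b2 \<longrightarrow> card {i\<in>{1..m}. hash_at \<omega> i = hash_at \<omega> (m+2)} = c2)"
    if \<omega>: "\<omega> \<in> space M" for \<omega>
  proof -
    have "\<omega> \<in> ?U \<longleftrightarrow> (\<exists>\<sigma>\<in>labelings m B1 a2 k. label_compat {A1, A2} \<sigma> {1..m+2} (atom_index \<omega>) \<and>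
        (\<forall>i\<in>{1..m+2}. hash_at \<omega> i \<in> ?T (\<sigma> i)))"
      using \<omega> by (simp add: label_event_def)
    also have "\<dots> \<longleftrightarrow> (hash_at \<omega> (m+1) = b1 \<and> hash_at \<omega> (m+2) = b2) \<and>
        (\<forall>l. int (card {i\<in>{1..m}. den_label (hash_at \<omega>) b1 b2 i = l}) = k l)"
      by (rule ex_labeling_iff, rule den_label_iff[OF a2_def])
    also have "\<dots> \<longleftrightarrow> (hash_at \<omega> (m+1) = b1 \<and> hash_at \<omega> (m+2) = b2) \<and>
      card {i\<in>{1..m}. hash_at \<omega> i = hash_at \<omega> (m+1)} = c1 \<and>
      (b1 \<noteq> b2 \<longrightarrow> card {i\<in>{1..m}. hash_at \<omega> i = hash_at \<omega> (m+2)} = c2)"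
      unfolding k_def by (intro conj_cong refl den_counts) simp_all
    finally show ?thesis .
  qed
  \<comment> \<open>The labellings say nothing about \<open>c2\<close> when the buckets agree, so
    the consistency condition \<open>c1 = c2\<close> is added here.\<close>
  have ae: "AE \<omega> in M. \<omega> \<in> den_part m c1 c2 (b1, b2) \<longleftrightarrow> (b1 = b2 \<longrightarrow> c1 = c2) \<and> \<omega> \<in> ?U"
    using AE_counts[of m] AE_space
  proof eventually_elim
    case (elim \<omega>)
    show ?case
      unfolding U[OF elim(2)] den_part_def using elim by auto
  qed
  have mass: "label_mass ?T B1 = a" "b1 \<noteq> b2 \<Longrightarrow> label_mass ?T B2 = a"
    "label_mass ?T R = (if b1 = b2 then \<theta> - a else \<theta> - 2 * a)"
  proof -
    show "label_mass ?T B1 = a" by (rule label_mass_singleton[OF b(1)]) (simp add: den_T_def)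
    show "label_mass ?T B2 = a" if "b1 \<noteq> b2"
      by (rule label_mass_singleton[OF b(2)]) (use that in \<open>auto simp: den_T_def\<close>)
    have "label_mass ?T R = \<theta> - real (card {b1, b2}) * a"
      by (rule label_mass_compl) (use b J in \<open>auto simp: den_T_def\<close>)
    then show "label_mass ?T R = (if b1 = b2 then \<theta> - a else \<theta> - 2 * a)" by simp
  qed
  have "prob ?U = fact m / pochhammer \<theta> (m + 2) *
      (\<Prod>l\<in>UNIV. inv_fact (k l) * label_weight {A1, A2} (label_mass ?T) l (nat (k l) + of_bool (B1 = l) + of_bool (a2 = l)))"
  proof (rule measure_labelings)
    show "?T l \<inter> ?T l' = {}" if "l \<notin> {A1, A2}" "l' \<notin> {A1, A2}" "l \<noteq> l'" for l l'
      using that by (cases l; cases l') (auto simp: den_T_def)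
    show "l = B1 \<or> l = a2 \<or> ?T l = {}" if "l \<in> {A1, A2}" for l
      using that by (auto simp: den_T_def)
    show "(\<Sum>l\<in>UNIV. k l) = int m"
      unfolding sum_label by (simp add: k_def count_label_def)
  qed
  also have "(\<Prod>l\<in>UNIV. inv_fact (k l) * label_weight {A1, A2} (label_mass ?T) l (nat (k l) + of_bool (B1 = l) + of_bool (a2 = l)))
    = (if b1 = b2 then pochhammer a (c1 + 2) / fact c1 * pf (\<theta> - a) (int m - int c1)
     else pochhammer a (c1 + 1) / fact c1 * (pochhammer a (c2 + 1) / fact c2) * pf (\<theta> - 2 * a) (int m - int c1 - int c2))"
    unfolding prod_label using mass
    by (auto simp: k_def a2_def count_label_def label_weight_def inv_fact_pochhammer inv_fact_def[of "int _"] inv_fact_def[of 0])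
  finally have prob_U: "prob ?U = fact m / pochhammer \<theta> (m + 2) *
    (if b1 = b2 then pochhammer a (c1 + 2) / fact c1 * pf (\<theta> - a) (int m - int c1)
     else pochhammer a (c1 + 1) / fact c1 * (pochhammer a (c2 + 1) / fact c2) * pf (\<theta> - 2 * a) (int m - int c1 - int c2))" .
  show ?thesis
  proof (cases "b1 = b2 \<longrightarrow> c1 = c2")
    case True
    have "prob (den_part m c1 c2 (b1, b2)) = prob ?U"
      using ae by (intro measure_eq_AE den_part_sets U_sets) (simp add: True)
    then show ?thesis unfolding prob_U using True by auto
  next
    case False
    have "prob (den_part m c1 c2 (b1, b2)) = prob {}"
      using ae False by (intro measure_eq_AE den_part_sets) auto
    then show ?thesis using False by auto
  qed
qed

lemma measure_num_part:
  assumes J: "J \<ge> 1" and b: "b1 \<in> {1..J}" "b2 \<in> {1..J}" and e: "e \<Longrightarrow> b1 = b2"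
  shows "measure M (num_part m l1 l2 c1 c2 (b1, b2, e)) = fact m / pochhammer \<theta> (m + 2) *
    (if e then (if l1 = l2 \<and> c1 = c2 then a * (real l1 + 1) * pf a (int c1 - int l1) * pf (\<theta> - a) (int m - int c1) else 0)
     else if b1 = b2 then (if c1 = c2 then a\<^sup>2 * pf a (int c1 - int l1 - int l2) * pf (\<theta> - a) (int m - int c1) else 0)
     else a\<^sup>2 * pf a (int c1 - int l1) * pf a (int c2 - int l2) * pf (\<theta> - 2 * a) (int m - int c1 - int c2))"
proof -
  interpret prob_space M by (rule prob_space_M)
  define a2 where "a2 = (if e then A1 else A2)"
  define k where "k = (if e then count_label (int l1) 0 (int c1 - int l1) 0 (int m - int c1)
         else if b1 = b2 then count_label (int l1) (int l2) (int c1 - int l1 - int l2) 0 (int m - int c1)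
         else count_label (int l1) (int l2) (int c1 - int l1) (int c2 - int l2) (int m - int c1 - int c2))"
  let ?T = "num_T e b1 b2"
  let ?U = "\<Union>\<sigma>\<in>labelings m A1 a2 k. label_event {A1, A2} ?T {1..m+2} \<sigma>"
  let ?C = "\<lambda>\<omega>. hash_at \<omega> (m+1) = b1 \<and> hash_at \<omega> (m+2) = b2 \<and> (atom_index \<omega> (m+1) = atom_index \<omega> (m+2)) = e"
  let ?N = "\<lambda>\<omega>. card {i\<in>{1..m}. atom_index \<omega> i = atom_index \<omega> (m+1)} = l1 \<and>
      (\<not> e \<longrightarrow> card {i\<in>{1..m}. atom_index \<omega> i = atom_index \<omega> (m+2)} = l2) \<and>
      card {i\<in>{1..m}. hash_at \<omega> i = hash_at \<omega> (m+1)} = c1 \<and>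
      (b1 \<noteq> b2 \<longrightarrow> card {i\<in>{1..m}. hash_at \<omega> i = hash_at \<omega> (m+2)} = c2)"
  have U_sets: "?U \<in> sets M"
    unfolding labelings_def
    by (intro sets.finite_UN label_event_sets finite_subset[OF _ finite_PiE[of "{1..m+2}" "\<lambda>_. UNIV"]]) auto
  have U: "\<omega> \<in> ?U \<longleftrightarrow> ?C \<omega> \<and> ?N \<omega>" if \<omega>: "\<omega> \<in> space M" for \<omega>
  proof -
    have hk: "hash_at \<omega> i = hash_at \<omega> i'" if "atom_index \<omega> i = atom_index \<omega> i'" for i i'
      using that by (simp add: hash_at_def)
    have "\<omega> \<in> ?U \<longleftrightarrow> (\<exists>\<sigma>\<in>labelings m A1 a2 k. label_compat {A1, A2} \<sigma> {1..m+2} (atom_index \<omega>) \<and>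
        (\<forall>i\<in>{1..m+2}. hash_at \<omega> i \<in> ?T (\<sigma> i)))"
      using \<omega> by (simp add: label_event_def)
    also have "\<dots> \<longleftrightarrow> ?C \<omega> \<and>
        (\<forall>l. int (card {i\<in>{1..m}. num_label m (atom_index \<omega>) (hash_at \<omega>) b1 b2 i = l}) = k l)"
      by (rule ex_labeling_iff, rule num_label_iff[OF hk a2_def e])
    also have "\<dots> \<longleftrightarrow> ?C \<omega> \<and> ?N \<omega>"
      unfolding k_def by (intro conj_cong refl num_counts hk) simp_all
    finally show ?thesis .
  qed
  have ae: "AE \<omega> in M. \<omega> \<in> num_part m l1 l2 c1 c2 (b1, b2, e) \<longleftrightarrow>
      (e \<longrightarrow> l1 = l2) \<and> (b1 = b2 \<longrightarrow> c1 = c2) \<and> \<omega> \<in> ?U"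
    using AE_counts[of m] AE_space
  proof eventually_elim
    case (elim \<omega>)
    show ?case
      unfolding U[OF elim(2)] num_part_def using elim by (cases e) auto
  qed
  have mass: "label_mass ?T A1 = a" "\<not> e \<Longrightarrow> label_mass ?T A2 = a"
    "label_mass ?T B1 = a" "b1 \<noteq> b2 \<Longrightarrow> label_mass ?T B2 = a"
    "label_mass ?T R = (if b1 = b2 then \<theta> - a else \<theta> - 2 * a)"
  proof -
    show "label_mass ?T B1 = a" by (rule label_mass_singleton[OF b(1)]) (simp add: num_T_def)
    show "label_mass ?T B2 = a" if "b1 \<noteq> b2"
      by (rule label_mass_singleton[OF b(2)]) (use that in \<open>auto simp: num_T_def\<close>)
    have "label_mass ?T R = \<theta> - real (card {b1, b2}) * a"
      by (rule label_mass_compl) (use b J in \<open>auto simp: num_T_def\<close>)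
    then show "label_mass ?T R = (if b1 = b2 then \<theta> - a else \<theta> - 2 * a)" by simp
    show "label_mass ?T A1 = a" by (rule label_mass_singleton[OF b(1)]) (simp add: num_T_def)
    show "label_mass ?T A2 = a" if "\<not> e"
      by (rule label_mass_singleton[OF b(2)]) (use that in \<open>simp add: num_T_def\<close>)
  qed
  have "prob ?U = fact m / pochhammer \<theta> (m + 2) *
      (\<Prod>l\<in>UNIV. inv_fact (k l) * label_weight {A1, A2} (label_mass ?T) l (nat (k l) + of_bool (A1 = l) + of_bool (a2 = l)))"
  proof (rule measure_labelings)
    show "?T l \<inter> ?T l' = {}" if "l \<notin> {A1, A2}" "l' \<notin> {A1, A2}" "l \<noteq> l'" for l l'
      using that by (cases l; cases l') (auto simp: num_T_def)
    show "l = A1 \<or> l = a2 \<or> ?T l = {}" if "l \<in> {A1, A2}" for l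
      using that by (auto simp: num_T_def a2_def)
    show "(\<Sum>l\<in>UNIV. k l) = int m"
      unfolding sum_label by (simp add: k_def count_label_def)
  qed
  also have "(\<Prod>l\<in>UNIV. inv_fact (k l) * label_weight {A1, A2} (label_mass ?T) l (nat (k l) + of_bool (A1 = l) + of_bool (a2 = l)))
    = (if e then a * (real l1 + 1) * pf a (int c1 - int l1) * pf (\<theta> - a) (int m - int c1)
     else if b1 = b2 then a\<^sup>2 * pf a (int c1 - int l1 - int l2) * pf (\<theta> - a) (int m - int c1)
     else a\<^sup>2 * pf a (int c1 - int l1) * pf a (int c2 - int l2) * pf (\<theta> - 2 * a) (int m - int c1 - int c2))"
  proof -
    let ?F = "\<lambda>l. inv_fact (k l) * label_weight {A1, A2} (label_mass ?T) l (nat (k l) + of_bool (A1 = l) + of_bool (a2 = l))"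
    \<comment> \<open>Origin of \<open>l1 + 1\<close>: a common block holds \<open>l1\<close> old
      and two new samples, with weight \<open>a * fact (l1 + 1)\<close> against the multinomial
      \<open>1 / fact l1\<close>. With only one new sample in the block the factorials cancel and
      \<open>a\<close> is left.\<close>
    have "?F A1 = (if e then a * (real l1 + 1) else a)"
      using mass(1) by (simp add: k_def a2_def count_label_def label_weight_def inv_fact_def mult.commute)
    moreover have "?F A2 = (if e then 1 else a)"
      using mass(2) by (simp add: k_def a2_def count_label_def label_weight_def inv_fact_def)
    moreover have "?F B1 = (if \<not> e \<and> b1 = b2 then pf a (int c1 - int l1 - int l2) else pf a (int c1 - int l1))"
      using mass(3) by (simp add: k_def a2_def count_label_def label_weight_def inv_fact_pochhammer)
    moreover have "?F B2 = (if b1 = b2 then 1 else pf a (int c2 - int l2))"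
      using mass(4) e by (auto simp: k_def a2_def count_label_def label_weight_def inv_fact_pochhammer inv_fact_def[of 0])
    moreover have "?F R = (if b1 = b2 then pf (\<theta> - a) (int m - int c1) else pf (\<theta> - 2 * a) (int m - int c1 - int c2))"
      using mass(5) e by (auto simp: k_def a2_def count_label_def label_weight_def inv_fact_pochhammer)
    ultimately show ?thesis
      unfolding prod_label using e by (simp only: power2_eq_square) auto
  qed
  finally have prob_U: "prob ?U = fact m / pochhammer \<theta> (m + 2) *
    (if e then a * (real l1 + 1) * pf a (int c1 - int l1) * pf (\<theta> - a) (int m - int c1)
     else if b1 = b2 then a\<^sup>2 * pf a (int c1 - int l1 - int l2) * pf (\<theta> - a) (int m - int c1)
     else a\<^sup>2 * pf a (int c1 - int l1) * pf a (int c2 - int l2) * pf (\<theta> - 2 * a) (int m - int c1 - int c2))" .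
  show ?thesis
  proof (cases "(e \<longrightarrow> l1 = l2) \<and> (b1 = b2 \<longrightarrow> c1 = c2)")
    case True
    have "prob (num_part m l1 l2 c1 c2 (b1, b2, e)) = prob ?U"
      using ae by (intro measure_eq_AE num_part_sets U_sets) (simp add: True)
    then show ?thesis unfolding prob_U using True e by auto
  next
    case False
    have "AE \<omega> in M. \<omega> \<in> num_part m l1 l2 c1 c2 (b1, b2, e) \<longleftrightarrow> \<omega> \<in> {}"
      using ae by eventually_elim (use False in blast)
    then have "prob (num_part m l1 l2 c1 c2 (b1, b2, e)) = prob {}"
      by (intro measure_eq_AE num_part_sets) simp_all
    then show ?thesis using False e by auto
  qed
qed

lemma measure_buckets:
  assumes J: "J \<ge> 1"
  shows "measure M {\<omega> \<in> space M. bucket m \<omega> 1 = c1 \<and> bucket m \<omega> 2 = c2} = fact m / pochhammer \<theta> (m + 2) * Den \<theta> J m c1 c2"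
proof -
  interpret prob_space M by (rule prob_space_M)
  let ?K = "fact m / pochhammer \<theta> (m + 2)"
  let ?p = "if c1 = c2 then pochhammer a (c1 + 2) / fact c1 * pf (\<theta> - a) (int m - int c1) else 0"
  let ?q = "pochhammer a (c1 + 1) / fact c1 * (pochhammer a (c2 + 1) / fact c2) * pf (\<theta> - 2 * a) (int m - int c1 - int c2)"
  have "prob {\<omega> \<in> space M. bucket m \<omega> 1 = c1 \<and> bucket m \<omega> 2 = c2} = (\<Sum>b\<in>{1..J} \<times> {1..J}. prob (den_part m c1 c2 b))"
    unfolding den_part_def
  proof (rule measure_eq_sum_AE)
    show "AE \<omega> in M. (hash \<omega> (Xobs \<omega> (m+1)), hash \<omega> (Xobs \<omega> (m+2))) \<in> {1..J} \<times> {1..J}"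
      using AE_Xobs AE_hash_range[OF J]
    proof eventually_elim
      case (elim \<omega>)
      then have "hash \<omega> (Xobs \<omega> i) \<in> {1..J}" for i by metis
      then show ?case by blast
    qed
    show "{\<omega> \<in> space M. bucket m \<omega> 1 = c1 \<and> bucket m \<omega> 2 = c2} \<in> events"
      by (intro sets.sets_Collect_conj level_sets)
  qed (simp_all only: den_part_sets[unfolded den_part_def] finite_cartesian_product finite_atLeastAtMost)
  also have "\<dots> = (\<Sum>b1\<in>{1..J}. \<Sum>b2\<in>{1..J}. if b1 = b2 then ?K * ?p else ?K * ?q)"
    unfolding sum.cartesian_product
    by (intro sum.cong refl) (clarify, subst measure_den_part[OF J], auto)
  also have "\<dots> = ?K * (real J * ?p + real J * (real J - 1) * ?q)"
    unfolding sum_diag_offdiag by (simp only: distrib_left mult.left_commute)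
  also have "real J * ?p + real J * (real J - 1) * ?q = Den \<theta> J m c1 c2"
    unfolding Den_def Let_def by (simp add: mult_ac)
  finally show ?thesis .
qed

lemma measure_freqs_buckets:
  assumes J: "J \<ge> 1"
  shows "measure M {\<omega> \<in> space M. freq m \<omega> 1 = l1 \<and> freq m \<omega> 2 = l2 \<and> bucket m \<omega> 1 = c1 \<and> bucket m \<omega> 2 = c2}
    = fact m / pochhammer \<theta> (m + 2) * Num \<theta> J m l1 l2 c1 c2"
proof -
  interpret prob_space M by (rule prob_space_M)
  let ?K = "fact m / pochhammer \<theta> (m + 2)"
  let ?p = "if l1 = l2 \<and> c1 = c2 then a * (real l1 + 1) * pf a (int c1 - int l1) * pf (\<theta> - a) (int m - int c1) else 0"
  let ?p' = "if c1 = c2 then a\<^sup>2 * pf a (int c1 - int l1 - int l2) * pf (\<theta> - a) (int m - int c1) else 0"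
  let ?q = "a\<^sup>2 * pf a (int c1 - int l1) * pf a (int c2 - int l2) * pf (\<theta> - 2 * a) (int m - int c1 - int c2)"
  \<comment> \<open>One atom has one hash value, so a common atom with two different hash values is
    excluded.\<close>
  let ?B = "{b \<in> {1..J} \<times> {1..J} \<times> UNIV. snd (snd b) \<longrightarrow> fst b = fst (snd b)}"
  have "prob {\<omega> \<in> space M. freq m \<omega> 1 = l1 \<and> freq m \<omega> 2 = l2 \<and> bucket m \<omega> 1 = c1 \<and> bucket m \<omega> 2 = c2}
      = (\<Sum>b\<in>?B. prob (num_part m l1 l2 c1 c2 b))"
    unfolding num_part_def
  proof (rule measure_eq_sum_AE)
    show "AE \<omega> in M. (hash \<omega> (Xobs \<omega> (m+1)), hash \<omega> (Xobs \<omega> (m+2)), Xobs \<omega> (m+1) = Xobs \<omega> (m+2)) \<in> ?B"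
      using AE_Xobs AE_hash_range[OF J]
    proof eventually_elim
      case (elim \<omega>)
      then have "hash \<omega> (Xobs \<omega> i) \<in> {1..J}" for i by metis
      then show ?case by (simp del: atLeastAtMost_iff)
    qed
    show "{\<omega> \<in> space M. freq m \<omega> 1 = l1 \<and> freq m \<omega> 2 = l2 \<and> bucket m \<omega> 1 = c1 \<and> bucket m \<omega> 2 = c2} \<in> events"
      by (intro sets.sets_Collect_conj level_sets)
    show "finite ?B" by (rule finite_subset[of _ "{1..J} \<times> {1..J} \<times> UNIV"]) auto
  qed (simp only: num_part_sets[unfolded num_part_def])
  also have "\<dots> = (\<Sum>(b1, b2)\<in>{1..J} \<times> {1..J}. \<Sum>e\<in>{e. e \<longrightarrow> b1 = b2}. prob (num_part m l1 l2 c1 c2 (b1, b2, e)))"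
    unfolding split_def
    by (subst sum.Sigma) (auto intro!: sum.reindex_bij_witness[of _ "\<lambda>((b1, b2), e). (b1, b2, e)" "\<lambda>(b1, b2, e). ((b1, b2), e)"])
  also have "\<dots> = (\<Sum>b1\<in>{1..J}. \<Sum>b2\<in>{1..J}. if b1 = b2 then ?K * (?p + ?p') else ?K * ?q)"
    unfolding sum.cartesian_product
  proof (intro sum.cong refl, clarify)
    fix b1 b2 assume b: "b1 \<in> {1..J}" "b2 \<in> {1..J}"
    show "(\<Sum>e\<in>{e. e \<longrightarrow> b1 = b2}. prob (num_part m l1 l2 c1 c2 (b1, b2, e)))
      = (if b1 = b2 then ?K * (?p + ?p') else ?K * ?q)"
    proof (cases "b1 = b2")
      case True
      then have "{e. e \<longrightarrow> b1 = b2} = {True, False}" by auto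
      then have "(\<Sum>e\<in>{e. e \<longrightarrow> b1 = b2}. prob (num_part m l1 l2 c1 c2 (b1, b2, e)))
          = prob (num_part m l1 l2 c1 c2 (b1, b2, True)) + prob (num_part m l1 l2 c1 c2 (b1, b2, False))"
        by (simp only:) simp
      also have "\<dots> = ?K * ?p + ?K * ?p'"
        using measure_num_part[OF J b, of True m l1 l2 c1 c2] measure_num_part[OF J b, of False m l1 l2 c1 c2] True
        by (simp only: if_True if_False simp_thms)
      finally show ?thesis using True by (simp only: if_True distrib_left simp_thms)
    next
      case False
      then have "{e. e \<longrightarrow> b1 = b2} = {False}" by auto
      then show ?thesis
        using measure_num_part[OF J b, of False m l1 l2 c1 c2] False by simp
    qed
  qed
  also have "\<dots> = ?K * (real J * (?p + ?p') + real J * (real J - 1) * ?q)"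
    unfolding sum_diag_offdiag by (simp only: distrib_left mult.left_commute)
  also have "real J * (?p + ?p') + real J * (real J - 1) * ?q = Num \<theta> J m l1 l2 c1 c2"
  proof -
    \<comment> \<open>The three conversions turn the symmetric form in \<open>a\<close> into the
      coefficients of the three terms of \<open>Num\<close>.\<close>
    have "real J * a = \<theta>" "real J * a\<^sup>2 = \<theta>\<^sup>2 / real J"
      "real J * (real J - 1) * a\<^sup>2 = (real J - 1) / real J * \<theta>\<^sup>2"
      using J by (simp_all add: power2_eq_square)
    then have "real J * ?p = (if l1 = l2 \<and> c1 = c2
        then \<theta> * (real l1 + 1) * pf a (int c1 - int l1) * pf (\<theta> - a) (int m - int c1) else 0)"
      "real J * ?p' = (if c1 = c2
        then \<theta>\<^sup>2 / real J * pf a (int c1 - int l1 - int l2) * pf (\<theta> - a) (int m - int c1) else 0)"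
      "real J * (real J - 1) * ?q = (real J - 1) / real J * \<theta>\<^sup>2 * pf a (int c1 - int l1) * pf a (int c2 - int l2)
        * pf (\<theta> - 2 * a) (int m - int c1 - int c2)"
      by (simp_all only: mult.assoc[symmetric] mult_zero_right if_distrib[of "(*) (real J)"])
    then show ?thesis
      unfolding Num_def Let_def by (simp only: distrib_left)
  qed
  finally show ?thesis .
qed

end

theorem theorem3:
  fixes \<nu> :: "'v measure" and \<theta> :: real and m J l1 l2 c1 c2 :: nat
  assumes "prob_space \<nu>"
    and "{p \<in> space (\<nu> \<Otimes>\<^sub>M \<nu>). fst p = snd p} \<in> sets (\<nu> \<Otimes>\<^sub>M \<nu>)"
    and "nonatomic \<nu>"
    and "\<theta> > 0" and "m \<ge> 1" and "J \<ge> 2"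
    and "measure (dp_model \<nu> \<theta> J)
           {\<omega> \<in> space (dp_model \<nu> \<theta> J). bucket m \<omega> 1 = c1 \<and> bucket m \<omega> 2 = c2} > 0"
  shows "cond_prob (dp_model \<nu> \<theta> J)
           {\<omega> \<in> space (dp_model \<nu> \<theta> J). freq m \<omega> 1 = l1 \<and> freq m \<omega> 2 = l2}
           {\<omega> \<in> space (dp_model \<nu> \<theta> J). bucket m \<omega> 1 = c1 \<and> bucket m \<omega> 2 = c2}
         = Num \<theta> J m l1 l2 c1 c2 / Den \<theta> J m c1 c2"
proof -
  interpret dp_hash \<nu> \<theta> J
    by (rule dp_hash.intro[OF assms(1-4)])
  have J: "J \<ge> 1" using assms by simp
  have "{\<omega> \<in> space M. freq m \<omega> 1 = l1 \<and> freq m \<omega> 2 = l2} \<inter> {\<omega> \<in> space M. bucket m \<omega> 1 = c1 \<and> bucket m \<omega> 2 = c2}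
    = {\<omega> \<in> space M. freq m \<omega> 1 = l1 \<and> freq m \<omega> 2 = l2 \<and> bucket m \<omega> 1 = c1 \<and> bucket m \<omega> 2 = c2}"
    by auto
  note events = this
  have "fact m / pochhammer \<theta> (m + 2) \<noteq> 0"
    using pochhammer_pos[OF assms(4), of "m + 2"] by simp
  then show ?thesis
    unfolding cond_prob_def events measure_freqs_buckets[OF J] measure_buckets[OF J]
    by (rule mult_divide_mult_cancel_left)
qed

end
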